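(* Consider the noisy search problem with $1/\delta=2^L$ and the hierarchical Posterior Matching strategy ($hiePM$) described in the context, run with the variable-length stopping rule. For reliability $0<\epsilon<1$, the expected search time satisfies $$\mathbb{E}[\tau_{\epsilon,\delta}] \le \frac{\log(1/\delta)}{I(1/3,\,p[2^{-l}])} + \frac{\log(1/\epsilon)}{C_1(p[\delta])} + o\Big(\log\frac{1}{\delta\epsilon}\Big),$$ for any fixed $l>0$ such that $2^{-l} > \big(e\log\frac{1}{\delta\epsilon}\big)^{-K_h}$, where $$K_h := \min\Big\{ I\big(\tfrac13,p[\tfrac12]\big),\ \tfrac23 D\big(\tfrac13 B_1+\tfrac23 B_0\,\big\|\,B_0\big)\Big\}>0,$$ with $B_1=\mathrm{Bern}(1-p[1/2])$, $B_0=\mathrm{Bern}(p[1/2])$.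
   Context: Search problem: fix $\delta\in(0,1)$ with $N=1/\delta=2^L$ for an integer $L$. A target index $\theta$ is uniformly distributed on $\{1,\dots,N\}$. A noise profile $p:(0,1)\to(0,1/2)$ is continuous and non-decreasing; write $p[x]:=p(x)$. At each time $t=1,2,\dots$ an agent chooses a query set $S_t\subseteq\{1,\dots,N\}$ as a function of past queries and observations, and observes $Y_t=\mathbb{1}(\theta\in S_t)\oplus Z_t$ ($\oplus$ = XOR), where conditionally on $S_t$, $Z_t\sim\mathrm{Bern}(p[\delta|S_t|])$, conditionally i.i.d. across time. The posterior is $\pi_i(t)=\mathbb{P}(\theta=i\mid S_1,\dots,S_t,Y_1,\dots,Y_t)$ with $\pi_i(0)=\delta$; write $\pi_S=\sum_{i\in S}\pi_i$. Variable-length stopping rule: $\tau_{\epsilon,\delta}$ is the first $t$ with $\max_i\pi_i(t)>1-\epsilon$, estimate $\hat\theta=\arg\max_i\pi_i(\tau)$. $hiePM$: let $H_l^m=\{m2^{L-l}+1,\dots,(m+1)2^{L-l}\}$ for $l=0,\dots,L$, $m=0,\dots,2^l-1$ (so $H_l^m=H_{l+1}^{2m}\cup H_{l+1}^{2m+1}$). At time $t$, let $l^*_t$ be the largest $l$ with $\max_m\pi_{H_l^m}(t)\ge\tfrac12$, and $m^*_t=\arg\max_m\pi_{H^m_{l^*_t}}(t)$. Let $(l_{t+1},m_{t+1})$ be the minimizer of $|\pi_{H^{m'}_{l'}}(t)-\tfrac12|$ over $(l',m')\in\{(l^*_t,m^*_t),(l^*_t+1,2m^*_t),(l^*_t+1,2m^*_t+1)\}$,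 and query $S_{t+1}=H^{m_{t+1}}_{l_{t+1}}$. Notation: $D(\cdot\|\cdot)$ is KL divergence; a convex combination of Bernoulli distributions denotes their mixture. $I(q,p)$ is the mutual information between input $X\sim\mathrm{Bern}(q)$ and the output of a binary symmetric channel with crossover probability $p$. $C_1(p):=D(\mathrm{Bern}(p)\|\mathrm{Bern}(1-p))$. The $o(\cdot)$ term is as $\delta\to0$ or $\epsilon\to0$. *)

theory Defs
  imports "HOL-Analysis.Analysis"
begin

definition bern_kl :: "real \<Rightarrow> real \<Rightarrow> real" where
  "bern_kl a b = a * ln (a / b) + (1 - a) * ln ((1 - a) / (1 - b))"

text \<open>Mutual information between X ~ Bern q and the output of BSC(p):
  sum over x, y of P(x) P(y|x) ln (P(y|x) / P(y)).\<close>
definition bsc_out1 :: "real \<Rightarrow> real \<Rightarrow> real" where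
  "bsc_out1 q p = q * (1 - p) + (1 - q) * p"

definition mutual_info :: "real \<Rightarrow> real \<Rightarrow> real" where
  "mutual_info q p =
      q * ((1 - p) * ln ((1 - p) / bsc_out1 q p) + p * ln (p / (1 - bsc_out1 q p)))
    + (1 - q) * (p * ln (p / bsc_out1 q p) + (1 - p) * ln ((1 - p) / (1 - bsc_out1 q p)))"

definition C1 :: "real \<Rightarrow> real" where
  "C1 p = bern_kl p (1 - p)"

text \<open>K_h = min { I(1/3, p[1/2]), 2/3 D(1/3 B_1 + 2/3 B_0 || B_0) },
  B_1 = Bern(1 - p[1/2]), B_0 = Bern(p[1/2]); the mixture is Bern(1/3 (1-p) + 2/3 p).\<close>
definition K_h :: "(real \<Rightarrow> real) \<Rightarrow> real" where
  "K_h p = min (mutual_info (1/3) (p (1/2)))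
               (2/3 * bern_kl (1/3 * (1 - p (1/2)) + 2/3 * p (1/2)) (p (1/2)))"

definition delta :: "nat \<Rightarrow> real" where
  "delta L = 1 / 2 ^ L"

definition H :: "nat \<Rightarrow> nat \<Rightarrow> nat \<Rightarrow> nat set" where
  "H L l m = {m * 2 ^ (L - l) + 1 .. (m + 1) * 2 ^ (L - l)}"

definition piS :: "(nat \<Rightarrow> real) \<Rightarrow> nat set \<Rightarrow> real" where
  "piS \<pi> S = (\<Sum>i\<in>S. \<pi> i)"

definition lstar :: "nat \<Rightarrow> (nat \<Rightarrow> real) \<Rightarrow> nat" where
  "lstar L \<pi> = Max {l. l \<le> L \<and> (\<exists>m < 2 ^ l. piS \<pi> (H L l m) \<ge> 1/2)}"

definition mstar :: "nat \<Rightarrow> (nat \<Rightarrow> real) \<Rightarrow> nat \<Rightarrow> nat" where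
  "mstar L \<pi> l = (LEAST m. m < 2 ^ l \<and> (\<forall>m' < 2 ^ l. piS \<pi> (H L l m') \<le> piS \<pi> (H L l m)))"

fun argmin_first :: "('a \<Rightarrow> real) \<Rightarrow> 'a list \<Rightarrow> 'a" where
  "argmin_first f [] = undefined"
| "argmin_first f [x] = x"
| "argmin_first f (x # y # zs) =
     (let w = argmin_first f (y # zs) in if f x \<le> f w then x else w)"

definition candidates :: "nat \<Rightarrow> (nat \<Rightarrow> real) \<Rightarrow> (nat \<times> nat) list" where
  "candidates L \<pi> =
     (let l = lstar L \<pi>; m = mstar L \<pi> l in
       (l, m) # (if l < L then [(l + 1, 2 * m), (l + 1, 2 * m + 1)] else []))"

definition query :: "nat \<Rightarrow> (nat \<Rightarrow> real) \<Rightarrow> nat set" where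
  "query L \<pi> =
     (case argmin_first (\<lambda>(l, m). \<bar>piS \<pi> (H L l m) - 1/2\<bar>) (candidates L \<pi>) of
        (l, m) \<Rightarrow> H L l m)"

text \<open>Probability of observing y when the target is i and the current posterior is pi:
  Y = 1(i in S) xor Z with Z ~ Bern(p[delta |S|]).\<close>
definition lik :: "nat \<Rightarrow> (real \<Rightarrow> real) \<Rightarrow> (nat \<Rightarrow> real) \<Rightarrow> nat \<Rightarrow> bool \<Rightarrow> real" where
  "lik L p \<pi> i y =
     (let S = query L \<pi>; q = p (delta L * real (card S)) in
        if (i \<in> S) = y then 1 - q else q)"

definition update :: "nat \<Rightarrow> (real \<Rightarrow> real) \<Rightarrow> (nat \<Rightarrow> real) \<Rightarrow> bool \<Rightarrow> (nat \<Rightarrow> real)" where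
  "update L p \<pi> y =
     (\<lambda>i. \<pi> i * lik L p \<pi> i y / (\<Sum>j\<in>{1..2 ^ L}. \<pi> j * lik L p \<pi> j y))"

definition prior :: "nat \<Rightarrow> nat \<Rightarrow> real" where
  "prior L = (\<lambda>i. if i \<in> {1..2 ^ L} then delta L else 0)"

definition post :: "nat \<Rightarrow> (real \<Rightarrow> real) \<Rightarrow> bool list \<Rightarrow> (nat \<Rightarrow> real)" where
  "post L p ys = fold (\<lambda>y \<pi>. update L p \<pi> y) ys (prior L)"

definition obs_prob :: "nat \<Rightarrow> (real \<Rightarrow> real) \<Rightarrow> nat \<Rightarrow> bool list \<Rightarrow> real" where
  "obs_prob L p i ys = (\<Prod>t<length ys. lik L p (post L p (take t ys)) i (ys ! t))"

definition stopped :: "nat \<Rightarrow> real \<Rightarrow> (nat \<Rightarrow> real) \<Rightarrow> bool" where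
  "stopped L \<epsilon> \<pi> = (\<exists>i\<in>{1..2 ^ L}. \<pi> i > 1 - \<epsilon>)"

text \<open>P(tau_{eps,delta} > t), theta uniform on {1..N}.\<close>
definition tail_prob :: "nat \<Rightarrow> (real \<Rightarrow> real) \<Rightarrow> real \<Rightarrow> nat \<Rightarrow> real" where
  "tail_prob L p \<epsilon> t =
     (\<Sum>i\<in>{1..2 ^ L}. delta L *
        (\<Sum>ys\<in>{ys :: bool list. length ys = t}.
           obs_prob L p i ys *
           (if (\<forall>s\<le>t. \<not> stopped L \<epsilon> (post L p (take s ys))) then 1 else 0)))"

text \<open>E[tau_{eps,delta}] = sum_{t>=0} P(tau > t) (possibly infinite).\<close>
definition expected_tau :: "nat \<Rightarrow> (real \<Rightarrow> real) \<Rightarrow> real \<Rightarrow> ennreal" where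
  "expected_tau L p \<epsilon> = (\<Sum>t. ennreal (tail_prob L p \<epsilon> t))"

end

theory Submission
  imports Defs
begin

text \<open>
  The expected search time is bounded by a potential that decreases by at least one per query in
  expectation. If no leaf has mass at least one half, the queried set has mass between 1/3 and 2/3,
  so the posterior entropy drops by at least \<open>I(1/3, p)\<close> at the noise level \<open>p\<close> of the query. A query
  above level \<open>l\<close> instead lowers the entropy of the level-\<open>l\<close> cell of the target by
  \<open>I(1/3, p[1/2])\<close> or more; that entropy never increases in mean and starts at \<open>l ln 2\<close>, so such queries
  cost a constant in total. If a leaf has mass \<open>s \<ge> 1/2\<close>, it is queried itself. The positive part of
  the log-odds of the true target is a submartingale, which then gains \<open>s C\<^sub>1(p[\<delta>])\<close>, while by concavity
  of the mutual information the entropy still drops by \<open>(1 - s) I(1/3, p)\<close>. The log-odds overshoot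
  the threshold by at most \<open>ln ((1 - p[\<delta>]) / p[\<delta>])\<close>, which divided by \<open>C\<^sub>1(p[\<delta>])\<close> is
  \<open>1 / (1 - 2 p[\<delta>])\<close>, bounded even if \<open>p[\<delta>]\<close> tends to 0. The error term is thus a constant
  depending on \<open>l\<close> and \<open>p\<close> only.
\<close>

subsection \<open>Mutual information and entropy\<close>

lemma ln_ratio_ge:
  fixes a b :: real
  assumes "0 < a" "0 < b"
  shows "a * ln (a / b) \<ge> a - b"
proof -
  have "ln (b / a) \<le> b / a - 1"
    using assms by (intro ln_le_minus_one) auto
  then have "a * ln (b / a) \<le> b - a"
    using assms by (simp add: field_simps)
  moreover have "ln (b / a) = - ln (a / b)"
    using assms by (simp add: ln_div)
  ultimately show ?thesis by (simp add: algebra_simps)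
qed

lemma ln_ratio_gt:
  fixes a b :: real
  assumes "0 < a" "0 < b" "a \<noteq> b"
  shows "a * ln (a / b) > a - b"
proof -
  have "ln (b / a) \<noteq> b / a - 1"
    using assms ln_eq_minus_one[of "b / a"] by auto
  then have "ln (b / a) < b / a - 1"
    using assms ln_le_minus_one[of "b / a"] by auto
  then have "a * ln (b / a) < b - a"
    using assms by (simp add: field_simps)
  moreover have "ln (b / a) = - ln (a / b)"
    using assms by (simp add: ln_div)
  ultimately show ?thesis by (simp add: algebra_simps)
qed

lemma bern_kl_nonneg:
  assumes "0 < a" "a < 1" "0 < b" "b < 1"
  shows "bern_kl a b \<ge> 0"
  using ln_ratio_ge[of a b] ln_ratio_ge[of "1 - a" "1 - b"] assms
  by (simp add: bern_kl_def)

lemma bern_kl_pos: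
  assumes "0 < a" "a < 1" "0 < b" "b < 1" "a \<noteq> b"
  shows "bern_kl a b > 0"
  using ln_ratio_gt[of a b] ln_ratio_gt[of "1 - a" "1 - b"] assms
  by (simp add: bern_kl_def)

text \<open>Binary entropy in nats. Writing mutual information as a difference of two of its values
  yields concavity in the input weight and monotonicity in the noise.\<close>

definition hbin :: "real \<Rightarrow> real" where
  "hbin x = - x * ln x - (1 - x) * ln (1 - x)"

lemma hbin_deriv:
  assumes "0 < x" "x < 1"
  shows "(hbin has_real_derivative ln ((1 - x) / x)) (at x)"
proof -
  have "(hbin has_real_derivative (- ln x - x * (1 / x)) + (ln (1 - x) + (1 - x) * (1 / (1 - x)))) (at x)"
    unfolding hbin_def[abs_def] using assms
    by (auto intro!: derivative_eq_intros)
  then show ?thesis using assms by (simp add: ln_div)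
qed

lemma hbin_concave: "concave_on {0<..<1} hbin"
proof (rule f''_le0_imp_concave)
  fix x :: real assume x: "x \<in> {0<..<1}"
  then show "(hbin has_real_derivative ln ((1 - x) / x)) (at x)"
    by (intro hbin_deriv) auto
  have "((\<lambda>x::real. ln (1 - x) - ln x) has_real_derivative - (1 / (1 - x)) - 1 / x) (at x)"
    using x by (auto intro!: derivative_eq_intros)
  moreover have "\<forall>\<^sub>F y in nhds x. ln ((1 - y) / y) = ln (1 - y) - ln (y::real)"
    using eventually_nhds_in_open[of "{0<..<1}" x] x
    by (auto elim!: eventually_mono simp: ln_div)
  ultimately show "((\<lambda>x. ln ((1 - x) / x)) has_real_derivative - (1 / (1 - x)) - 1 / x) (at x)"
    by (subst DERIV_cong_ev[OF refl _ refl]) auto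
  show "- (1 / (1 - x)) - 1 / x \<le> 0"
    using x by (auto simp: field_simps)
qed auto

lemma bsc_out1_range:
  assumes "0 \<le> s" "s \<le> 1" "0 < q" "q < 1"
  shows "0 < bsc_out1 s q" "bsc_out1 s q < 1"
proof -
  have *: "0 < s * u + (1 - s) * v" if "0 < u" "0 < v" for u v :: real
    using assms that by (cases "s = 0") (auto intro: add_pos_nonneg)
  show "0 < bsc_out1 s q" using *[of "1 - q" q] assms by (simp add: bsc_out1_def)
  have "1 - bsc_out1 s q = s * q + (1 - s) * (1 - q)"
    by (simp add: bsc_out1_def algebra_simps)
  then show "bsc_out1 s q < 1" using *[of q "1 - q"] assms by linarith
qed

lemma mutual_info_kl:
  "mutual_info s q = s * bern_kl (1 - q) (bsc_out1 s q) + (1 - s) * bern_kl q (bsc_out1 s q)"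
  by (simp add: mutual_info_def bern_kl_def)

lemma mutual_info_hbin:
  assumes "0 \<le> s" "s \<le> 1" "0 < q" "q < 1"
  shows "mutual_info s q = hbin (bsc_out1 s q) - hbin q"
proof -
  define r where "r = bsc_out1 s q"
  have r: "0 < r" "r < 1" using bsc_out1_range[OF assms] by (auto simp: r_def)
  have "mutual_info s q = - (s * (1 - q) + (1 - s) * q) * ln r
      - (1 - (s * (1 - q) + (1 - s) * q)) * ln (1 - r) - hbin q"
    using r assms unfolding mutual_info_def r_def[symmetric] hbin_def
    by (simp add: ln_div algebra_simps)
  then show ?thesis by (simp add: r_def hbin_def bsc_out1_def)
qed

text \<open>At fixed noise the output probability is affine in the input weight, and only the
  concave term \<open>hbin (bsc_out1 s q)\<close> depends on that weight.\<close>

lemma mutual_info_concave: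
  assumes "0 < q" "q < 1"
  shows "concave_on {0..1} (\<lambda>s. mutual_info s q)"
  unfolding concave_on_def
proof (rule convex_onI)
  fix t x y :: real
  assume t: "0 < t" "t < 1" and xy: "x \<in> {0..1}" "y \<in> {0..1}"
  have z: "(1 - t) *\<^sub>R x + t *\<^sub>R y \<in> {0..1}"
    using t xy by (intro convexD_alt[of "{0..1::real}"]) auto
  have out: "bsc_out1 ((1 - t) *\<^sub>R x + t *\<^sub>R y) q
      = (1 - t) *\<^sub>R bsc_out1 x q + t *\<^sub>R bsc_out1 y q"
    by (simp add: bsc_out1_def algebra_simps)
  have "hbin (bsc_out1 ((1 - t) *\<^sub>R x + t *\<^sub>R y) q)
      \<ge> (1 - t) * hbin (bsc_out1 x q) + t * hbin (bsc_out1 y q)"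
    unfolding out using t xy assms
    by (intro concave_onD[OF hbin_concave]) (auto intro: bsc_out1_range)
  then show "- mutual_info ((1 - t) *\<^sub>R x + t *\<^sub>R y) q
      \<le> (1 - t) * - mutual_info x q + t * - mutual_info y q"
    using xy z assms by (simp add: mutual_info_hbin algebra_simps)
qed auto

lemma mutual_info_swap: "mutual_info (1 - s) q = mutual_info s q"
proof -
  have swap: "bsc_out1 (1 - s) q = 1 - bsc_out1 s q" by (simp add: bsc_out1_def algebra_simps)
  show ?thesis unfolding mutual_info_def swap by (simp add: add_ac)
qed

text \<open>Concavity keeps the function above its chord, and the chord is horizontal because
  \<open>mutual_info_swap\<close> exchanges the endpoints.\<close>

lemma mutual_info_middle:
  assumes "0 < q" "q < 1" "1/3 \<le> s" "s \<le> 2/3"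
  shows "mutual_info (1/3) q \<le> mutual_info s q"
proof -
  define t where "t = 3 * s - 1"
  have t: "0 \<le> t" "t \<le> 1" and s: "s = (1 - t) *\<^sub>R (1/3) + t *\<^sub>R (2/3)"
    using assms by (auto simp: t_def field_simps)
  have "mutual_info s q \<ge> (1 - t) * mutual_info (1/3) q + t * mutual_info (2/3) q"
    unfolding s using t by (intro concave_onD[OF mutual_info_concave]) (use assms in auto)
  then show ?thesis using mutual_info_swap[of "1/3" q] by (simp add: algebra_simps)
qed

lemma mutual_info_nonneg:
  assumes "0 \<le> s" "s \<le> 1" "0 < q" "q < 1"
  shows "mutual_info s q \<ge> 0"
  unfolding mutual_info_kl using assms bsc_out1_range[OF assms]
  by (intro add_nonneg_nonneg mult_nonneg_nonneg bern_kl_nonneg) auto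

lemma mutual_info_pos:
  assumes "0 < s" "s \<le> 1/2" "0 < q" "q < 1/2"
  shows "mutual_info s q > 0"
proof -
  have "bsc_out1 s q - q = s * (1 - 2 * q)" by (simp add: bsc_out1_def algebra_simps)
  moreover have "s * (1 - 2 * q) > 0" using assms by simp
  ultimately have ne: "q \<noteq> bsc_out1 s q" by auto
  have r: "0 < bsc_out1 s q" "bsc_out1 s q < 1" using bsc_out1_range[of s q] assms by auto
  show ?thesis unfolding mutual_info_kl using assms r ne
    by (intro add_nonneg_pos mult_nonneg_nonneg mult_pos_pos bern_kl_nonneg bern_kl_pos) auto
qed

text \<open>The chord from 1/2 to 1 gives the factor \<open>2 * (1 - s)\<close>, of which half
  suffices. When a leaf of mass \<open>s\<close> is queried, \<open>1 - s\<close> complements the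
  share \<open>s\<close> paid by the log-odds.\<close>

lemma mutual_info_large:
  assumes "0 < q" "q < 1" "1/2 \<le> s" "s \<le> 1"
  shows "(1 - s) * mutual_info (1/3) q \<le> mutual_info s q"
proof -
  define t where "t = 2 * s - 1"
  have t: "0 \<le> t" "t \<le> 1" and s: "s = (1 - t) *\<^sub>R (1/2) + t *\<^sub>R 1"
    using assms by (auto simp: t_def field_simps)
  have "mutual_info s q \<ge> (1 - t) * mutual_info (1/2) q + t * mutual_info 1 q"
    unfolding s using t by (intro concave_onD[OF mutual_info_concave]) (use assms in auto)
  moreover have "mutual_info 1 q \<ge> 0" "mutual_info (1/3) q \<ge> 0"
    using assms by (auto intro: mutual_info_nonneg)
  moreover have "mutual_info (1/2) q \<ge> mutual_info (1/3) q"
    using assms by (intro mutual_info_middle) auto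
  ultimately have "(1 - t) * mutual_info (1/3) q \<le> mutual_info s q"
    using t by (smt (verit) mult_left_mono mult_nonneg_nonneg)
  moreover have "(1 - s) * mutual_info (1/3) q \<le> (1 - t) * mutual_info (1/3) q"
    using \<open>mutual_info (1/3) q \<ge> 0\<close> assms by (intro mult_right_mono) (auto simp: t_def)
  ultimately show ?thesis by linarith
qed

text \<open>For \<open>r = (1 + x) / 3\<close>, the output probability, x < r < 1/2. The derivative
  of the binary entropy is decreasing and nonnegative there, so a third of its value at r is at most
  its value at x.\<close>

lemma mutual_info_antimono:
  assumes "0 < q" "q \<le> q'" "q' < 1/2"
  shows "mutual_info (1/3) q' \<le> mutual_info (1/3) q"
proof -
  have "hbin ((1 + q') / 3) - hbin q' \<le> hbin ((1 + q) / 3) - hbin q"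
  proof (rule DERIV_nonpos_imp_nonincreasing[OF assms(2)])
    fix x assume x: "q \<le> x" "x \<le> q'"
    then have x': "0 < x" "x < 1/2" using assms by auto
    let ?r = "(1 + x) / 3"
    have "((\<lambda>x. hbin ((1 + x) / 3)) has_real_derivative ln ((1 - ?r) / ?r) * (1/3)) (at x)"
      by (rule DERIV_chain2[OF hbin_deriv]) (use x' in \<open>auto intro!: derivative_eq_intros\<close>)
    then have "((\<lambda>x. hbin ((1 + x) / 3) - hbin x) has_real_derivative
        ln ((1 - ?r) / ?r) * (1/3) - ln ((1 - x) / x)) (at x)"
      using x' by (intro derivative_intros hbin_deriv) auto
    moreover have "ln ((1 - ?r) / ?r) * (1/3) - ln ((1 - x) / x) \<le> 0"
    proof -
      have "ln ((1 - ?r) / ?r) \<le> ln ((1 - x) / x)"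
        using x' by (subst ln_le_cancel_iff) (auto simp: field_simps)
      moreover have "0 \<le> ln ((1 - x) / x)" using x' by (intro ln_ge_zero) (simp add: field_simps)
      ultimately show ?thesis by linarith
    qed
    ultimately show "\<exists>y. ((\<lambda>x. hbin ((1 + x) / 3) - hbin x) has_real_derivative y) (at x) \<and> y \<le> 0"
      by blast
  qed
  moreover have "mutual_info (1/3) x = hbin ((1 + x) / 3) - hbin x" if "0 < x" "x < 1" for x
  proof -
    have out: "bsc_out1 (1/3) x = (1 + x) / 3" by (simp add: bsc_out1_def field_simps)
    show ?thesis using mutual_info_hbin[of "1/3" x] that unfolding out by auto
  qed
  ultimately show ?thesis using assms by simp
qed

text \<open>The logarithm is the largest move of a log-odds by one answer of noise \<open>q\<close>.
  Dividing it by \<open>C1 q\<close> leaves \<open>1 / (1 - 2 * q)\<close>, which stays bounded as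
  \<open>q\<close> tends to 0.\<close>

lemma C1_eq:
  assumes "0 < q" "q < 1"
  shows "C1 q = (1 - 2 * q) * ln ((1 - q) / q)"
  using assms by (simp add: C1_def bern_kl_def ln_div algebra_simps)

lemma C1_pos:
  assumes "0 < q" "q < 1/2"
  shows "C1 q > 0"
  using assms unfolding C1_def by (intro bern_kl_pos) auto

lemma K_h_pos:
  assumes "0 < p (1/2)" "p (1/2) < 1/2"
  shows "K_h p > 0"
proof -
  have "0 < bern_kl (1/3 * (1 - p (1/2)) + 2/3 * p (1/2)) (p (1/2))"
    using assms by (intro bern_kl_pos) (auto simp: field_simps)
  then show ?thesis using mutual_info_pos[of "1/3" "p (1/2)"] assms by (simp add: K_h_def)
qed

section \<open>Entropy under a Bayes update\<close>

definition ent :: "'a set \<Rightarrow> ('a \<Rightarrow> real) \<Rightarrow> real" where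
  "ent X w = - (\<Sum>c\<in>X. w c * ln (w c))"

lemma ent_nonneg:
  assumes "finite X" "\<And>c. c \<in> X \<Longrightarrow> 0 < w c" "(\<Sum>c\<in>X. w c) = 1"
  shows "ent X w \<ge> 0"
proof -
  have "w c \<le> 1" if "c \<in> X" for c
    using member_le_sum[of c X w] that assms by (auto intro: less_imp_le)
  then have "(\<Sum>c\<in>X. w c * ln (w c)) \<le> 0"
    using assms by (intro sum_nonpos mult_nonneg_nonpos) (auto intro: less_imp_le)
  then show ?thesis by (simp add: ent_def)
qed

lemma ent_uniform:
  assumes "finite X" "\<And>c. c \<in> X \<Longrightarrow> w c = 1 / 2 ^ k" "card X = 2 ^ k"
  shows "ent X w = real k * ln 2"
proof -
  have "ent X w = - (\<Sum>c\<in>X. 1 / 2 ^ k * ln (1 / 2 ^ k))"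
    unfolding ent_def using assms(2) by (intro arg_cong[of _ _ uminus] sum.cong) auto
  then show ?thesis using assms(3) by (simp add: ln_div ln_realpow)
qed

lemma sum_weighted_range:
  fixes w a :: "'a \<Rightarrow> real"
  assumes "finite X" "X \<noteq> {}" "\<And>c. c \<in> X \<Longrightarrow> 0 < w c" "(\<Sum>c\<in>X. w c) = 1"
    and "\<And>c. c \<in> X \<Longrightarrow> 0 < a c \<and> a c < 1"
  shows "0 < (\<Sum>c\<in>X. w c * a c)" "(\<Sum>c\<in>X. w c * a c) < 1"
proof -
  show "0 < (\<Sum>c\<in>X. w c * a c)" using assms by (intro sum_pos) auto
  have "(\<Sum>c\<in>X. w c * a c) < (\<Sum>c\<in>X. w c)" using assms by (intro sum_strict_mono) auto
  then show "(\<Sum>c\<in>X. w c * a c) < 1" using assms by simp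
qed

text \<open>Chain rule for a binary observation: \<open>a c\<close> is the probability of a positive
  answer in state \<open>c\<close>, and the subtracted sum is the information between state and
  answer. The general index set serves both single targets and dyadic cells.\<close>

lemma ent_bayes:
  fixes w a :: "'a \<Rightarrow> real"
  assumes X: "finite X" "X \<noteq> {}" and w: "\<And>c. c \<in> X \<Longrightarrow> 0 < w c" "(\<Sum>c\<in>X. w c) = 1"
    and a: "\<And>c. c \<in> X \<Longrightarrow> 0 < a c \<and> a c < 1"
  defines "m \<equiv> \<Sum>c\<in>X. w c * a c"
  shows "m * ent X (\<lambda>c. w c * a c / m) + (1 - m) * ent X (\<lambda>c. w c * (1 - a c) / (1 - m))
       = ent X w - (\<Sum>c\<in>X. w c * bern_kl (a c) m)"
proof -
  have m: "0 < m" "m < 1" using sum_weighted_range[OF assms(1-5)] by (auto simp: m_def)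
  have "m * ent X (\<lambda>c. w c * a c / m) + (1 - m) * ent X (\<lambda>c. w c * (1 - a c) / (1 - m))
     = (\<Sum>c\<in>X. - (w c * a c * ln (w c * a c / m))
              - w c * (1 - a c) * ln (w c * (1 - a c) / (1 - m)))"
    using m by (simp add: ent_def sum_distrib_left sum_negf sum_subtractf)
  also have "\<dots> = (\<Sum>c\<in>X. - (w c * ln (w c)) - w c * bern_kl (a c) m)"
  proof (intro sum.cong refl)
    fix c assume "c \<in> X"
    then have c: "0 < w c" "0 < a c" "0 < 1 - a c" using w a by auto
    have 1: "ln (w c * a c / m) = ln (w c) + ln (a c / m)"
      using c m by (simp add: ln_mult ln_div)
    have 2: "ln (w c * (1 - a c) / (1 - m)) = ln (w c) + ln ((1 - a c) / (1 - m))"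
      using c m by (simp add: ln_mult ln_div)
    show "- (w c * a c * ln (w c * a c / m)) - w c * (1 - a c) * ln (w c * (1 - a c) / (1 - m))
        = - (w c * ln (w c)) - w c * bern_kl (a c) m"
      unfolding 1 2 bern_kl_def by (simp add: algebra_simps)
  qed
  also have "\<dots> = ent X w - (\<Sum>c\<in>X. w c * bern_kl (a c) m)"
    by (simp add: ent_def sum_negf sum_subtractf)
  finally show ?thesis .
qed

text \<open>The answer depends on the state only through \<open>P\<close>, so the information is
  that of a binary symmetric channel whose input is the truth value of \<open>P\<close>.\<close>

lemma sum_bern_kl_eq_mutual_info:
  fixes w a :: "'a \<Rightarrow> real"
  assumes X: "finite X" and w: "(\<Sum>c\<in>X. w c) = 1"
    and a: "\<And>c. c \<in> X \<Longrightarrow> a c = (if P c then 1 - q else q)"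
    and s: "s = (\<Sum>c\<in>{c\<in>X. P c}. w c)"
  shows "(\<Sum>c\<in>X. w c * bern_kl (a c) (\<Sum>c\<in>X. w c * a c)) = mutual_info s q"
proof -
  have split: "(\<Sum>c\<in>X. w c * (if P c then u else v)) = s * u + (1 - s) * v" for u v :: real
  proof -
    have "(\<Sum>c\<in>X. w c * (if P c then u else v)) = (\<Sum>c\<in>X. w c * v + (if P c then w c else 0) * (u - v))"
      by (intro sum.cong) (auto simp: algebra_simps)
    also have "\<dots> = v + s * (u - v)"
      unfolding sum.distrib sum_distrib_right[symmetric] w s
      using X by (simp add: sum.inter_filter)
    finally show ?thesis by (simp add: algebra_simps)
  qed
  have m: "(\<Sum>c\<in>X. w c * a c) = bsc_out1 s q"
    using split[of "1 - q" q] a by (simp add: bsc_out1_def cong: sum.cong)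
  have "(\<Sum>c\<in>X. w c * bern_kl (a c) (bsc_out1 s q))
      = (\<Sum>c\<in>X. w c * (if P c then bern_kl (1 - q) (bsc_out1 s q) else bern_kl q (bsc_out1 s q)))"
    using a by (intro sum.cong) auto
  then show ?thesis unfolding m split mutual_info_kl .
qed

subsection \<open>The dyadic hierarchy\<close>

text \<open>With cells as fibres of integer division, partition and nesting become arithmetic of
  \<open>div\<close>. The shift by one accounts for targets numbered from 1.\<close>

lemma H_eq:
  assumes "l \<le> L" "m < 2 ^ l"
  shows "H L l m = {i \<in> {1..2 ^ L}. (i - 1) div 2 ^ (L - l) = m}"
proof -
  define K :: nat where "K = 2 ^ (L - l)"
  have K: "0 < K" "(2::nat) ^ L = 2 ^ l * K"
    using assms by (auto simp: K_def simp flip: power_add)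
  have le: "(m + 1) * K \<le> 2 ^ L"
    unfolding K using assms by (intro mult_right_mono) auto
  have "i \<in> {m * K + 1..(m + 1) * K} \<longleftrightarrow> i \<in> {1..2 ^ L} \<and> (i - 1) div K = m" for i
  proof (cases i)
    case (Suc j)
    have "j div K = m \<longleftrightarrow> m * K \<le> j \<and> j < (m + 1) * K"
      using K(1) by (metis Suc_eq_plus1 div_nat_eqI dividend_less_times_div
          mult.commute mult_Suc_right times_div_less_eq_dividend)
    then show ?thesis using le Suc by auto
  qed auto
  then show ?thesis unfolding H_def K_def[symmetric] by blast
qed

lemma H_subset: "l \<le> L \<Longrightarrow> m < 2 ^ l \<Longrightarrow> H L l m \<subseteq> {1..2 ^ L}"
  by (auto simp: H_eq)

lemma finite_H [simp]: "finite (H L l m)"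
  by (simp add: H_def)

lemma card_H [simp]: "card (H L l m) = 2 ^ (L - l)"
  by (simp add: H_def)

lemma cell_less:
  assumes "l \<le> L" "i \<in> {1..2 ^ L}"
  shows "(i - 1) div 2 ^ (L - l) < (2::nat) ^ l"
proof -
  have "i - 1 < 2 ^ l * 2 ^ (L - l)" using assms by (auto simp flip: power_add)
  then show ?thesis by (intro less_mult_imp_div_less)
qed

lemma sum_cells:
  assumes "l \<le> L"
  shows "(\<Sum>m<2 ^ l. \<Sum>i\<in>H L l m. f i) = (\<Sum>i\<in>{1..2 ^ L}. f i :: real)"
proof -
  have "(\<Sum>m<2 ^ l. \<Sum>i\<in>H L l m. f i)
      = (\<Sum>m<2 ^ l. \<Sum>i\<in>{i \<in> {1..2 ^ L}. (i - 1) div 2 ^ (L - l) = m}. f i)"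
    using assms by (intro sum.cong) (auto simp: H_eq)
  also have "\<dots> = (\<Sum>i\<in>{1..2 ^ L}. f i)"
    using assms cell_less by (intro sum.group) auto
  finally show ?thesis .
qed

text \<open>Dividing by \<open>2 ^ (L - j)\<close> amounts to dividing by \<open>2 ^ (L - l)\<close>
  and then by \<open>2 ^ (l - j)\<close>.\<close>

lemma H_nested:
  assumes "j \<le> l" "l \<le> L" "m < 2 ^ j" "k < 2 ^ l" "i \<in> H L l k"
  shows "i \<in> H L j m \<longleftrightarrow> k div 2 ^ (l - j) = m"
proof -
  have "(2::nat) ^ (L - j) = 2 ^ (L - l) * 2 ^ (l - j)"
    using assms by (simp flip: power_add)
  then have "(i - 1) div 2 ^ (L - j) = (i - 1) div 2 ^ (L - l) div 2 ^ (l - j)"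
    by (simp add: div_mult2_eq)
  then show ?thesis using assms by (auto simp: H_eq)
qed

lemma piS_children:
  assumes "j < L"
  shows "piS \<pi> (H L j m) = piS \<pi> (H L (j + 1) (2 * m)) + piS \<pi> (H L (j + 1) (2 * m + 1))"
proof -
  define K :: nat where "K = 2 ^ (L - (j + 1))"
  have "L - j = Suc (L - (j + 1))" using assms by simp
  then have K: "(2::nat) ^ (L - j) = 2 * K" by (simp only: K_def power_Suc)
  have "H L j m = H L (j + 1) (2 * m) \<union> H L (j + 1) (2 * m + 1)"
    unfolding H_def K K_def[symmetric] by (auto simp: algebra_simps)
  moreover have "H L (j + 1) (2 * m) \<inter> H L (j + 1) (2 * m + 1) = {}"
    unfolding H_def K_def[symmetric] by auto
  ultimately show ?thesis by (simp add: piS_def sum.union_disjoint)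
qed

section \<open>Positive posteriors and the query chosen by hiePM\<close>

definition belief :: "nat \<Rightarrow> (nat \<Rightarrow> real) \<Rightarrow> bool" where
  "belief L \<pi> \<longleftrightarrow> (\<forall>i\<in>{1..2 ^ L}. 0 < \<pi> i) \<and> (\<Sum>i\<in>{1..2 ^ L}. \<pi> i) = 1"

lemma belief_H_0: "belief L \<pi> \<Longrightarrow> piS \<pi> (H L 0 0) = 1"
  by (simp add: belief_def piS_def H_def)

lemma belief_piS_pos:
  assumes "belief L \<pi>" "l \<le> L" "m < 2 ^ l"
  shows "0 < piS \<pi> (H L l m)"
proof -
  have "H L l m \<noteq> {}" by (auto simp: H_def)
  then show ?thesis unfolding piS_def
    using assms H_subset[OF assms(2,3)] by (intro sum_pos) (auto simp: belief_def)
qed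

lemma belief_piS_le:
  assumes "belief L \<pi>" "S \<subseteq> {1..2 ^ L}"
  shows "piS \<pi> S \<le> 1"
proof -
  have "piS \<pi> S \<le> (\<Sum>i\<in>{1..2 ^ L}. \<pi> i)" unfolding piS_def
    using assms by (intro sum_mono2) (auto simp: belief_def intro: less_imp_le)
  then show ?thesis using assms by (simp add: belief_def)
qed

lemma lstar_spec:
  assumes "belief L \<pi>"
  shows "lstar L \<pi> \<le> L" "\<exists>m<2 ^ lstar L \<pi>. 1/2 \<le> piS \<pi> (H L (lstar L \<pi>) m)"
proof -
  have "0 \<in> {l. l \<le> L \<and> (\<exists>m<2 ^ l. piS \<pi> (H L l m) \<ge> 1/2)}"
    using belief_H_0[OF assms] by simp
  then have "lstar L \<pi> \<in> {l. l \<le> L \<and> (\<exists>m<2 ^ l. piS \<pi> (H L l m) \<ge> 1/2)}"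
    unfolding lstar_def by (intro Max_in) auto
  then show "lstar L \<pi> \<le> L" "\<exists>m<2 ^ lstar L \<pi>. 1/2 \<le> piS \<pi> (H L (lstar L \<pi>) m)" by auto
qed

lemma lstar_ge:
  assumes "l \<le> L" "m < 2 ^ l" "1/2 \<le> piS \<pi> (H L l m)"
  shows "l \<le> lstar L \<pi>"
  unfolding lstar_def using assms by (intro Max_ge) auto

text \<open>One of the two halves carries at least half of the mass. Hence the full set is never
  queried, and the argument of \<open>p\<close> stays inside (0,1).\<close>

lemma lstar_pos:
  assumes "belief L \<pi>" "1 \<le> L"
  shows "1 \<le> lstar L \<pi>"
proof -
  have "piS \<pi> (H L 1 0) + piS \<pi> (H L 1 1) = 1"
    using piS_children[of 0 L \<pi> 0] belief_H_0[OF assms(1)] assms by simp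
  then have "1/2 \<le> piS \<pi> (H L 1 0) \<or> 1/2 \<le> piS \<pi> (H L 1 1)" by linarith
  then show ?thesis using lstar_ge[of 1 L 0 \<pi>] lstar_ge[of 1 L 1 \<pi>] assms by auto
qed

lemma mstar_spec:
  shows "mstar L \<pi> l < 2 ^ l" "\<And>m. m < 2 ^ l \<Longrightarrow> piS \<pi> (H L l m) \<le> piS \<pi> (H L l (mstar L \<pi> l))"
proof -
  have "\<exists>m. m < 2 ^ l \<and> (\<forall>m'<2 ^ l. piS \<pi> (H L l m') \<le> piS \<pi> (H L l m))"
  proof -
    define F where "F = (\<lambda>m. piS \<pi> (H L l m)) ` {..<2 ^ l}"
    have fin: "finite F" "F \<noteq> {}" unfolding F_def by (auto simp: lessThan_empty_iff)
    then have "Max F \<in> F" by (rule Max_in)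
    then obtain m where "m < 2 ^ l" "Max F = piS \<pi> (H L l m)"
      unfolding F_def by auto
    moreover have "piS \<pi> (H L l m') \<le> Max F" if "m' < 2 ^ l" for m'
      using fin that unfolding F_def by (intro Max_ge) auto
    ultimately show ?thesis by auto
  qed
  from LeastI_ex[OF this]
  show "mstar L \<pi> l < 2 ^ l" "\<And>m. m < 2 ^ l \<Longrightarrow> piS \<pi> (H L l m) \<le> piS \<pi> (H L l (mstar L \<pi> l))"
    by (auto simp: mstar_def)
qed

text \<open>Collects what the drift estimates need about the strategy: while no leaf has mass 1/2
  the query is balanced, otherwise it is a single heavy leaf.\<close>

lemma query_spec:
  assumes "belief L \<pi>" "1 \<le> L"
  obtains j m where "query L \<pi> = H L j m" "m < 2 ^ j" "1 \<le> j" "j \<le> L"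
    "lstar L \<pi> \<le> j" "j \<le> lstar L \<pi> + 1"
    "lstar L \<pi> < L \<Longrightarrow> 1/3 \<le> piS \<pi> (H L j m) \<and> piS \<pi> (H L j m) \<le> 2/3"
    "lstar L \<pi> = L \<Longrightarrow> 1/2 \<le> piS \<pi> (H L j m)"
proof -
  define l where "l = lstar L \<pi>"
  define m where "m = mstar L \<pi> l"
  have l: "1 \<le> l" "l \<le> L" using lstar_pos lstar_spec assms by (auto simp: l_def)
  have m: "m < 2 ^ l" using mstar_spec(1) by (simp add: m_def)
  have a: "1/2 \<le> piS \<pi> (H L l m)"
    using lstar_spec(2)[OF assms(1)] mstar_spec(2)[of _ l \<pi> L]
    unfolding m_def l_def by (meson order_trans)
  show thesis
  proof (cases "l = L")
    case True
    then have "query L \<pi> = H L l m"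
      unfolding query_def candidates_def l_def[symmetric] Let_def m_def[symmetric] by simp
    then show thesis using True l m a by (intro that[of l m]) (auto simp: l_def)
  next
    case False
    then have lL: "l < L" using l by simp
    let ?f = "\<lambda>(j, k). \<bar>piS \<pi> (H L j k) - 1/2\<bar>"
    let ?A = "(l, m)" and ?B = "(l + 1, 2 * m)" and ?C = "(l + 1, 2 * m + 1)"
    \<comment> \<open>Maximality of \<open>lstar\<close> keeps every cell one level deeper below
      1/2.\<close>
    have child: "piS \<pi> (H L (l + 1) k) < 1/2" if "k < 2 ^ (l + 1)" for k
    proof (rule ccontr)
      assume "\<not> ?thesis"
      then have "l + 1 \<le> lstar L \<pi>" using that lL by (intro lstar_ge[of _ _ k]) auto
      then show False by (simp add: l_def)
    qed
    have bc: "piS \<pi> (H L (l + 1) (2 * m)) < 1/2" "piS \<pi> (H L (l + 1) (2 * m + 1)) < 1/2"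
      using m by (intro child; simp)+
    have sum: "piS \<pi> (H L l m) = piS \<pi> (H L (l + 1) (2 * m)) + piS \<pi> (H L (l + 1) (2 * m + 1))"
      by (rule piS_children[OF lL])
    \<comment> \<open>If the parent has mass above 2/3, its heavier child lies between 1/3 and 1/2;
      otherwise the parent itself lies between 1/2 and 2/3. Some candidate is thus within 1/6 of
      1/2.\<close>
    have "\<exists>x. argmin_first ?f [?A, ?B, ?C] = x \<and> x \<in> {?A, ?B, ?C} \<and> ?f x \<le> 1/6"
      using a bc sum by (auto simp: Let_def abs_if)
    then obtain j k where jk: "argmin_first ?f [?A, ?B, ?C] = (j, k)"
      "(j, k) \<in> {?A, ?B, ?C}" "?f (j, k) \<le> 1/6"
      by (metis surj_pair)
    have "query L \<pi> = H L j k"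
      using lL jk(1) unfolding query_def candidates_def l_def[symmetric] Let_def m_def[symmetric]
      by simp
    moreover have "k < 2 ^ j" using jk(2) m by auto
    moreover have "1/3 \<le> piS \<pi> (H L j k) \<and> piS \<pi> (H L j k) \<le> 2/3"
      using jk(3) by (auto simp: abs_if split: if_splits)
    ultimately show thesis using jk(2) l lL by (intro that[of j k]) (auto simp: l_def)
  qed
qed

subsection \<open>Drift of entropy and log-odds\<close>

definition logit :: "real \<Rightarrow> real" where
  "logit w = ln (w / (1 - w))"

text \<open>The odds are multiplied by the likelihood ratio \<open>a / r\<close>, where
  \<open>r\<close> is the likelihood of the answer when the hypothesis is false.\<close>

lemma logit_bayes:
  assumes "0 < w" "w < 1" "0 < a" "0 < r"
  shows "logit (w * a / (w * a + (1 - w) * r)) = logit w + ln (a / r)"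
proof -
  define m where "m = w * a + (1 - w) * r"
  have m: "0 < m" using assms unfolding m_def by (intro add_pos_pos) auto
  have "1 - w * a / m = (1 - w) * r / m" using m by (simp add: m_def field_simps)
  then have "w * a / m / (1 - w * a / m) = (w / (1 - w)) * (a / r)" using m by simp
  then show ?thesis using assms unfolding logit_def m_def[symmetric]
    by (simp add: ln_mult ln_div)
qed

text \<open>Under the hypothesis the log-odds grow on average by the divergence of the answer law
  from its law under the alternative, and truncation at 0 only raises the result. The truncated form
  has the advantage of starting from 0 at the uniform prior instead of from a large negative
  value.\<close>

lemma max0_logit_drift:
  fixes w a r :: real
  assumes w: "0 < w" "w < 1" and a: "0 < a" "a < 1" and r: "0 < r" "r < 1"
  defines "m \<equiv> w * a + (1 - w) * r"
  defines "E \<equiv> a * max 0 (logit (w * a / m)) + (1 - a) * max 0 (logit (w * (1 - a) / (1 - m)))"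
  shows "logit w + bern_kl a r \<le> E" "max 0 (logit w) \<le> E"
proof -
  have m1: "1 - m = w * (1 - a) + (1 - w) * (1 - r)" by (simp add: m_def algebra_simps)
  have T: "logit (w * a / m) = logit w + ln (a / r)"
    unfolding m_def using assms by (intro logit_bayes) auto
  have F: "logit (w * (1 - a) / (1 - m)) = logit w + ln ((1 - a) / (1 - r))"
    unfolding m1 using assms by (intro logit_bayes) auto
  have "a * logit (w * a / m) + (1 - a) * logit (w * (1 - a) / (1 - m)) \<le> E"
    unfolding E_def using a by (intro add_mono mult_left_mono) auto
  then show *: "logit w + bern_kl a r \<le> E"
    unfolding T F by (simp add: bern_kl_def algebra_simps)
  have "0 \<le> E" unfolding E_def using a by (intro add_nonneg_nonneg mult_nonneg_nonneg) auto
  then show "max 0 (logit w) \<le> E" using * bern_kl_nonneg[OF a r] by linarith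
qed

lemma sum_lists_Suc:
  "(\<Sum>ys\<in>{ys :: bool list. length ys = Suc t}. f ys)
     = (\<Sum>ys\<in>{ys. length ys = t}. f (True # ys)) + (\<Sum>ys\<in>{ys. length ys = t}. f (False # ys) :: real)"
proof -
  have fin: "finite {ys :: bool list. length ys = t}"
    using finite_lists_length_eq[of "UNIV :: bool set" t] by simp
  have "{ys :: bool list. length ys = Suc t} = (#) True ` {ys. length ys = t} \<union> (#) False ` {ys. length ys = t}"
    by (auto simp: length_Suc_conv image_iff)
  then have "(\<Sum>ys\<in>{ys :: bool list. length ys = Suc t}. f ys)
      = (\<Sum>ys\<in>(#) True ` {ys. length ys = t}. f ys) + (\<Sum>ys\<in>(#) False ` {ys. length ys = t}. f ys)"
    using fin by (simp only:) (intro sum.union_disjoint; auto)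
  then show ?thesis by (simp add: sum.reindex inj_on_def)
qed

section \<open>One step of the search as a Bayes update\<close>

locale hiepm =
  fixes L :: nat and p :: "real \<Rightarrow> real" and \<epsilon> :: real
  assumes L_pos: "1 \<le> L"
    and p_range: "\<And>x. x \<in> {0<..<1} \<Longrightarrow> 0 < p x \<and> p x < 1/2"
    and p_mono: "mono_on {0<..<1} p"
    and eps_range: "0 < \<epsilon>" "\<epsilon> < 1"
begin

abbreviation "N \<equiv> {1..2 ^ L :: nat}"

abbreviation noise :: "(nat \<Rightarrow> real) \<Rightarrow> real" where
  "noise \<pi> \<equiv> p (delta L * real (card (query L \<pi>)))"

definition prob_yes :: "(nat \<Rightarrow> real) \<Rightarrow> nat \<Rightarrow> real" where
  "prob_yes \<pi> i = (if i \<in> query L \<pi> then 1 - noise \<pi> else noise \<pi>)"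

definition marg_yes :: "(nat \<Rightarrow> real) \<Rightarrow> real" where
  "marg_yes \<pi> = (\<Sum>i\<in>N. \<pi> i * prob_yes \<pi> i)"

text \<open>Conditional expectation of \<open>F\<close> at the next posterior. This operator stands
  in for a probability space: the posterior process is Markov and each query has two
  outcomes.\<close>

definition expect_next :: "(nat \<Rightarrow> real) \<Rightarrow> ((nat \<Rightarrow> real) \<Rightarrow> real) \<Rightarrow> real" where
  "expect_next \<pi> F = marg_yes \<pi> * F (update L p \<pi> True)
                     + (1 - marg_yes \<pi>) * F (update L p \<pi> False)"

lemma delta_range: "delta L \<in> {0<..<1}" "delta L \<le> 1/2"
proof -
  have "(2::real) ^ 1 \<le> 2 ^ L" using L_pos by (intro power_increasing) auto
  then show "delta L \<in> {0<..<1}" "delta L \<le> 1/2" by (auto simp: delta_def field_simps)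
qed

lemma noise_level:
  assumes "query L \<pi> = H L j m" "1 \<le> j" "j \<le> L"
  shows "noise \<pi> = p (1 / 2 ^ j)" "(1::real) / 2 ^ j \<in> {0<..<1}" "delta L \<le> 1 / 2 ^ j"
proof -
  have "(2::real) ^ L = 2 ^ j * 2 ^ (L - j)" using assms by (simp flip: power_add)
  then show "noise \<pi> = p (1 / 2 ^ j)" using assms by (simp add: delta_def)
  have "(2::real) ^ 1 \<le> 2 ^ j" using assms by (intro power_increasing) auto
  then show "(1::real) / 2 ^ j \<in> {0<..<1}" by (auto simp: field_simps)
  show "delta L \<le> 1 / 2 ^ j"
    unfolding delta_def using assms by (intro divide_left_mono) (auto intro: power_increasing)
qed

lemma noise_mono:
  assumes "1 \<le> i" "i \<le> j"
  shows "p (1 / 2 ^ j) \<le> p (1 / 2 ^ i)"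
proof (rule mono_onD[OF p_mono])
  have *: "(1::real) / 2 ^ k \<in> {0<..<1}" if "1 \<le> k" for k
    using power_increasing[of 1 k "2::real"] that by (auto simp: field_simps)
  show "(1::real) / 2 ^ j \<in> {0<..<1}" "(1::real) / 2 ^ i \<in> {0<..<1}"
    using assms by (intro *; simp)+
  show "(1::real) / 2 ^ j \<le> 1 / 2 ^ i"
    using assms by (intro divide_left_mono power_increasing) auto
qed

lemma noise_range:
  assumes "belief L \<pi>"
  shows "0 < noise \<pi>" "noise \<pi> < 1/2" "p (delta L) \<le> noise \<pi>"
proof -
  obtain j m where jm: "query L \<pi> = H L j m" "1 \<le> j" "j \<le> L"
    using query_spec[OF assms L_pos] by metis
  note n = noise_level[OF jm]
  show "0 < noise \<pi>" "noise \<pi> < 1/2" using p_range[OF n(2)] n(1) by auto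
  show "p (delta L) \<le> noise \<pi>"
    unfolding n(1) using n(2,3) delta_range by (intro mono_onD[OF p_mono]) auto
qed

lemma lik_True: "lik L p \<pi> i True = prob_yes \<pi> i"
  by (simp add: lik_def prob_yes_def Let_def)

lemma lik_False: "lik L p \<pi> i False = 1 - prob_yes \<pi> i"
  by (simp add: lik_def prob_yes_def Let_def)

lemma prob_yes_range:
  assumes "belief L \<pi>"
  shows "0 < prob_yes \<pi> i \<and> prob_yes \<pi> i < 1"
    "noise \<pi> \<le> prob_yes \<pi> i \<and> prob_yes \<pi> i \<le> 1 - noise \<pi>"
  using noise_range[OF assms] by (auto simp: prob_yes_def)

lemma marg_yes_range:
  assumes "belief L \<pi>"
  shows "0 < marg_yes \<pi>" "marg_yes \<pi> < 1"
  unfolding marg_yes_def using assms prob_yes_range[OF assms]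
  by (intro sum_weighted_range; auto simp: belief_def)+

lemma update_True: "update L p \<pi> True = (\<lambda>i. \<pi> i * prob_yes \<pi> i / marg_yes \<pi>)"
  by (simp add: update_def lik_True marg_yes_def)

lemma marg_no:
  assumes "belief L \<pi>"
  shows "(\<Sum>i\<in>N. \<pi> i * (1 - prob_yes \<pi> i)) = 1 - marg_yes \<pi>"
  using assms by (simp add: belief_def marg_yes_def right_diff_distrib sum_subtractf)

lemma update_False:
  assumes "belief L \<pi>"
  shows "update L p \<pi> False = (\<lambda>i. \<pi> i * (1 - prob_yes \<pi> i) / (1 - marg_yes \<pi>))"
  unfolding update_def lik_False marg_no[OF assms] ..

text \<open>Positivity persists since noise strictly between 0 and 1/2 keeps every likelihood
  positive.\<close>

lemma belief_update:
  assumes "belief L \<pi>"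
  shows "belief L (update L p \<pi> y)"
proof -
  note m = marg_yes_range[OF assms] and a = prob_yes_range(1)[OF assms]
  show ?thesis
  proof (cases y)
    case True
    then show ?thesis using m a assms
      by (auto simp: belief_def update_True marg_yes_def simp flip: sum_divide_distrib)
  next
    case False
    then show ?thesis using m a assms marg_no[OF assms] update_False[OF assms]
      by (auto simp: belief_def simp flip: sum_divide_distrib)
  qed
qed

lemma ent_drift:
  assumes "belief L \<pi>"
  shows "expect_next \<pi> (ent N) = ent N \<pi> - mutual_info (piS \<pi> (query L \<pi>)) (noise \<pi>)"
proof -
  obtain j m where jm: "query L \<pi> = H L j m" "j \<le> L" "m < 2 ^ j"
    using query_spec[OF assms L_pos] by metis
  have "query L \<pi> \<subseteq> N" using H_subset jm by simp
  then have "{i \<in> N. i \<in> query L \<pi>} = query L \<pi>" by blast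
  then have "(\<Sum>i\<in>N. \<pi> i * bern_kl (prob_yes \<pi> i) (marg_yes \<pi>))
      = mutual_info (piS \<pi> (query L \<pi>)) (noise \<pi>)"
    unfolding marg_yes_def using assms
    by (intro sum_bern_kl_eq_mutual_info[where P = "\<lambda>i. i \<in> query L \<pi>"])
       (auto simp: belief_def prob_yes_def piS_def)
  moreover have "expect_next \<pi> (ent N)
      = ent N \<pi> - (\<Sum>i\<in>N. \<pi> i * bern_kl (prob_yes \<pi> i) (marg_yes \<pi>))"
    unfolding expect_next_def update_True update_False[OF assms] marg_yes_def
    using assms prob_yes_range(1)[OF assms] by (intro ent_bayes) (auto simp: belief_def)
  ultimately show ?thesis by simp
qed

text \<open>The entropy of the level-\<open>l\<close> cell containing the target, whose initial value \<open>l * ln 2\<close>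
  does not grow with \<open>L\<close>.\<close>

definition coarse_ent :: "nat \<Rightarrow> (nat \<Rightarrow> real) \<Rightarrow> real" where
  "coarse_ent l \<pi> = ent {..<2 ^ l} (\<lambda>m. piS \<pi> (H L l m))"

lemma coarse_belief:
  assumes "belief L \<pi>" "l \<le> L"
  shows "(\<Sum>m<2 ^ l. piS \<pi> (H L l m)) = 1"
  using assms sum_cells[of l L \<pi>] by (simp add: piS_def belief_def)

text \<open>Here \<open>b m\<close> averages the answer probability over cell \<open>m\<close>, so
  the cell masses undergo a Bayes update of their own with likelihood \<open>b\<close>, and
  \<open>ent_bayes\<close> applies at the coarse level.\<close>

lemma coarse_ent_drift_eq:
  fixes \<pi> l
  defines "W \<equiv> \<lambda>m. piS \<pi> (H L l m)"
  defines "b \<equiv> \<lambda>m. (\<Sum>i\<in>H L l m. \<pi> i * prob_yes \<pi> i) / W m"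
  assumes \<pi>: "belief L \<pi>" and l: "l \<le> L"
  shows "expect_next \<pi> (coarse_ent l) = coarse_ent l \<pi> - (\<Sum>m<2 ^ l. W m * bern_kl (b m) (marg_yes \<pi>))"
    and "marg_yes \<pi> = (\<Sum>m<2 ^ l. W m * b m)"
    and "m < 2 ^ l \<Longrightarrow> 0 < b m \<and> b m < 1"
proof -
  note a = prob_yes_range(1)[OF \<pi>]
  have W: "0 < W m" if "m < 2 ^ l" for m
    unfolding W_def using \<pi> l that by (rule belief_piS_pos)
  have pos: "0 < \<pi> i" if "i \<in> H L l m" "m < 2 ^ l" for i m
    using that \<pi> l H_subset[of l L m] by (auto simp: belief_def)
  have ne: "H L l m \<noteq> {}" for m by (simp add: H_def)
  have yes: "(\<Sum>i\<in>H L l m. \<pi> i * prob_yes \<pi> i) = W m * b m" if "m < 2 ^ l" for m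
    using W[OF that] by (simp add: b_def)
  have no: "(\<Sum>i\<in>H L l m. \<pi> i * (1 - prob_yes \<pi> i)) = W m * (1 - b m)" if "m < 2 ^ l" for m
    using W[OF that] by (simp add: b_def W_def piS_def right_diff_distrib sum_subtractf)
  have b: "0 < b m \<and> b m < 1" if "m < 2 ^ l" for m
  proof -
    have "0 < W m * b m" unfolding yes[OF that, symmetric]
      using ne a pos that by (intro sum_pos) auto
    moreover have "0 < W m * (1 - b m)" unfolding no[OF that, symmetric]
      using ne a pos that by (intro sum_pos) auto
    ultimately show ?thesis using W[OF that] by (auto simp: zero_less_mult_iff)
  qed
  then show "m < 2 ^ l \<Longrightarrow> 0 < b m \<and> b m < 1" .
  show m: "marg_yes \<pi> = (\<Sum>m<2 ^ l. W m * b m)"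
    unfolding marg_yes_def using sum_cells[OF l, of "\<lambda>i. \<pi> i * prob_yes \<pi> i"] yes by simp
  have T: "coarse_ent l (update L p \<pi> True) = ent {..<2 ^ l} (\<lambda>m. W m * b m / marg_yes \<pi>)"
    unfolding coarse_ent_def ent_def
    by (intro arg_cong[of _ _ uminus] sum.cong)
       (simp_all add: update_True piS_def yes flip: sum_divide_distrib)
  have F: "coarse_ent l (update L p \<pi> False) = ent {..<2 ^ l} (\<lambda>m. W m * (1 - b m) / (1 - marg_yes \<pi>))"
    unfolding coarse_ent_def ent_def
    by (intro arg_cong[of _ _ uminus] sum.cong)
       (simp_all add: update_False[OF \<pi>] piS_def no flip: sum_divide_distrib)
  have "marg_yes \<pi> * ent {..<2 ^ l} (\<lambda>m. W m * b m / marg_yes \<pi>)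
      + (1 - marg_yes \<pi>) * ent {..<2 ^ l} (\<lambda>m. W m * (1 - b m) / (1 - marg_yes \<pi>))
      = ent {..<2 ^ l} W - (\<Sum>m<2 ^ l. W m * bern_kl (b m) (marg_yes \<pi>))"
    unfolding m using W b coarse_belief[OF \<pi> l]
    by (intro ent_bayes) (auto simp: W_def lessThan_empty_iff)
  then show "expect_next \<pi> (coarse_ent l)
      = coarse_ent l \<pi> - (\<Sum>m<2 ^ l. W m * bern_kl (b m) (marg_yes \<pi>))"
    unfolding expect_next_def T F by (simp add: coarse_ent_def W_def)
qed

text \<open>The information about the cell is an average of divergences, hence nonnegative, even
  when the query splits a cell.\<close>

lemma coarse_ent_drift_le:
  assumes "belief L \<pi>" "l \<le> L"
  shows "expect_next \<pi> (coarse_ent l) \<le> coarse_ent l \<pi>"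
proof -
  have "0 \<le> (\<Sum>m<2 ^ l. piS \<pi> (H L l m) *
      bern_kl ((\<Sum>i\<in>H L l m. \<pi> i * prob_yes \<pi> i) / piS \<pi> (H L l m)) (marg_yes \<pi>))"
    using assms belief_piS_pos[OF assms] coarse_ent_drift_eq(3)[OF assms] marg_yes_range[OF assms(1)]
    by (intro sum_nonneg mult_nonneg_nonneg bern_kl_nonneg) (auto intro: less_imp_le)
  then show ?thesis using coarse_ent_drift_eq(1)[OF assms] by simp
qed

text \<open>A query at level \<open>j \<le> l\<close> is a union of level-\<open>l\<close> cells, so
  \<open>b\<close> takes only two values and the whole information of the answer concerns the coarse
  cell.\<close>

lemma coarse_ent_drift:
  assumes \<pi>: "belief L \<pi>" and l: "l \<le> L"
    and S: "query L \<pi> = H L j k" and k: "k < 2 ^ j" and j: "j \<le> l"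
  shows "expect_next \<pi> (coarse_ent l) = coarse_ent l \<pi> - mutual_info (piS \<pi> (query L \<pi>)) (noise \<pi>)"
proof -
  define W where "W = (\<lambda>m. piS \<pi> (H L l m))"
  define b where "b = (\<lambda>m. (\<Sum>i\<in>H L l m. \<pi> i * prob_yes \<pi> i) / W m)"
  define P where "P = (\<lambda>m. m div 2 ^ (l - j) = k)"
  have in_S: "i \<in> query L \<pi> \<longleftrightarrow> P m" if "m < 2 ^ l" "i \<in> H L l m" for i m
    unfolding S P_def using H_nested[OF j l k that] .
  have b: "b m = (if P m then 1 - noise \<pi> else noise \<pi>)" if "m < 2 ^ l" for m
  proof -
    have "(\<Sum>i\<in>H L l m. \<pi> i * prob_yes \<pi> i)
        = (\<Sum>i\<in>H L l m. \<pi> i * (if P m then 1 - noise \<pi> else noise \<pi>))"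
      using in_S[OF that] by (intro sum.cong) (auto simp: prob_yes_def)
    also have "\<dots> = W m * (if P m then 1 - noise \<pi> else noise \<pi>)"
      by (simp add: W_def piS_def sum_distrib_right)
    finally show ?thesis using belief_piS_pos[OF \<pi> l that] by (simp add: b_def W_def)
  qed
  have sub: "query L \<pi> \<subseteq> N" unfolding S using H_subset j l k by simp
  have "piS \<pi> (query L \<pi>) = (\<Sum>i\<in>N. if i \<in> query L \<pi> then \<pi> i else 0)"
    using sub by (simp add: piS_def sum.If_cases Int_absorb1)
  also have "\<dots> = (\<Sum>m<2 ^ l. \<Sum>i\<in>H L l m. if i \<in> query L \<pi> then \<pi> i else 0)"
    by (rule sum_cells[OF l, symmetric])
  also have "\<dots> = (\<Sum>m<2 ^ l. if P m then W m else 0)"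
    using in_S by (intro sum.cong) (auto simp: W_def piS_def intro!: sum.cong)
  also have "\<dots> = (\<Sum>m\<in>{m \<in> {..<2 ^ l}. P m}. W m)"
    by (rule sum.inter_filter[symmetric]) simp
  finally have mass: "piS \<pi> (query L \<pi>) = (\<Sum>m\<in>{m \<in> {..<2 ^ l}. P m}. W m)" .
  have "(\<Sum>m<2 ^ l. W m * bern_kl (b m) (\<Sum>m<2 ^ l. W m * b m))
      = mutual_info (piS \<pi> (query L \<pi>)) (noise \<pi>)"
    using b coarse_belief[OF \<pi> l] mass
    by (intro sum_bern_kl_eq_mutual_info[where P = P]) (auto simp: W_def)
  then show ?thesis
    using coarse_ent_drift_eq(1,2)[OF \<pi> l] by (simp add: W_def b_def)
qed

text \<open>Posterior expectation of the positive part of the log-odds of the true target.\<close>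

definition gain :: "(nat \<Rightarrow> real) \<Rightarrow> real" where
  "gain \<pi> = (\<Sum>i\<in>N. \<pi> i * max 0 (logit (\<pi> i)))"

text \<open>The probability of a positive answer given that the target is not \<open>i\<close>.\<close>

definition rest_yes :: "(nat \<Rightarrow> real) \<Rightarrow> nat \<Rightarrow> real" where
  "rest_yes \<pi> i = (\<Sum>j\<in>N - {i}. \<pi> j * prob_yes \<pi> j) / (1 - \<pi> i)"

lemma belief_less_1:
  assumes "belief L \<pi>" "i \<in> N"
  shows "\<pi> i < 1" "(\<Sum>j\<in>N - {i}. \<pi> j) = 1 - \<pi> i"
proof -
  have "card (N - {i}) \<ge> 1"
    using power_increasing[of 1 L "2::nat"] L_pos assms by simp
  then have "N - {i} \<noteq> {}" by (metis card.empty not_one_le_zero)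
  then have "0 < (\<Sum>j\<in>N - {i}. \<pi> j)"
    using assms by (intro sum_pos) (auto simp: belief_def)
  then show "\<pi> i < 1" "(\<Sum>j\<in>N - {i}. \<pi> j) = 1 - \<pi> i"
    using assms sum.remove[of N i \<pi>] by (auto simp: belief_def)
qed

text \<open>The bounds hold because \<open>rest_yes\<close> is a weighted average of probabilities
  between the noise and its complement.\<close>

lemma rest_yes_spec:
  assumes "belief L \<pi>" "i \<in> N"
  shows "marg_yes \<pi> = \<pi> i * prob_yes \<pi> i + (1 - \<pi> i) * rest_yes \<pi> i"
    "noise \<pi> \<le> rest_yes \<pi> i" "rest_yes \<pi> i \<le> 1 - noise \<pi>"
proof -
  note l1 = belief_less_1[OF assms]
  show "marg_yes \<pi> = \<pi> i * prob_yes \<pi> i + (1 - \<pi> i) * rest_yes \<pi> i"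
    using l1(1) sum.remove[of N i "\<lambda>j. \<pi> j * prob_yes \<pi> j"] assms
    by (simp add: marg_yes_def rest_yes_def)
  have "(\<Sum>j\<in>N - {i}. \<pi> j * noise \<pi>) \<le> (\<Sum>j\<in>N - {i}. \<pi> j * prob_yes \<pi> j)"
    using assms prob_yes_range(2)[OF assms(1)]
    by (intro sum_mono mult_left_mono) (auto simp: belief_def intro: less_imp_le)
  then show "noise \<pi> \<le> rest_yes \<pi> i"
    unfolding sum_distrib_right[symmetric] l1(2)
    using l1(1) by (simp add: rest_yes_def le_divide_eq mult.commute)
  have "(\<Sum>j\<in>N - {i}. \<pi> j * prob_yes \<pi> j) \<le> (\<Sum>j\<in>N - {i}. \<pi> j * (1 - noise \<pi>))"
    using assms prob_yes_range(2)[OF assms(1)]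
    by (intro sum_mono mult_left_mono) (auto simp: belief_def intro: less_imp_le)
  then show "rest_yes \<pi> i \<le> 1 - noise \<pi>"
    unfolding sum_distrib_right[symmetric] l1(2)
    using l1(1) by (simp add: rest_yes_def divide_le_eq mult.commute)
qed

text \<open>The increment is the logarithm of a likelihood ratio with numerator at most
  \<open>1 - noise\<close> and denominator at least the noise, and no query is less noisy than that
  of a leaf.\<close>

lemma logit_update_le:
  assumes "belief L \<pi>" "i \<in> N"
  shows "logit (update L p \<pi> y i) \<le> logit (\<pi> i) + ln ((1 - p (delta L)) / p (delta L))"
proof -
  let ?q = "noise \<pi>" and ?a = "prob_yes \<pi> i" and ?r = "rest_yes \<pi> i"
  note q = noise_range[OF assms(1)] and r = rest_yes_spec[OF assms]
    and a = prob_yes_range[OF assms(1), of i] and l1 = belief_less_1(1)[OF assms]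
  have d: "0 < p (delta L)" using p_range[OF delta_range(1)] by simp
  have w: "0 < \<pi> i" using assms by (simp add: belief_def)
  have jump: "ln (u / v) \<le> ln ((1 - p (delta L)) / p (delta L))"
    if "0 < u" "u \<le> 1 - ?q" "?q \<le> v" for u v
    using that q d by (subst ln_le_cancel_iff) (auto intro!: frac_le)
  show ?thesis
  proof (cases y)
    case True
    have "logit (update L p \<pi> y i) = logit (\<pi> i) + ln (?a / ?r)"
      using True w l1 a r q by (simp add: update_True logit_bayes)
    then show ?thesis using jump[of ?a ?r] a r by simp
  next
    case False
    have "1 - marg_yes \<pi> = \<pi> i * (1 - ?a) + (1 - \<pi> i) * (1 - ?r)"
      unfolding r(1) by (simp add: algebra_simps)
    then have "logit (update L p \<pi> y i) = logit (\<pi> i) + ln ((1 - ?a) / (1 - ?r))"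
      using False w l1 a r(2,3) q by (simp add: update_False[OF assms(1)] logit_bayes)
    then show ?thesis using jump[of "1 - ?a" "1 - ?r"] a r by simp
  qed
qed

text \<open>Given target \<open>i\<close>, \<open>max0_logit_drift\<close> applies with
  \<open>rest_yes\<close> as the law under the alternative. If leaf \<open>k\<close> is queried,
  that law has exactly the noise as its parameter, so the divergence for \<open>k\<close> is
  \<open>C1\<close>, and the other targets do not lose.\<close>

lemma gain_drift_le:
  assumes "belief L \<pi>"
  shows "gain \<pi> \<le> expect_next \<pi> gain"
    and "k \<in> N \<Longrightarrow> query L \<pi> = {k} \<Longrightarrow> 1/2 \<le> \<pi> k \<Longrightarrow>
      gain \<pi> + \<pi> k * C1 (p (delta L)) \<le> expect_next \<pi> gain"
proof -
  define m where "m = marg_yes \<pi>"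
  define E where "E = (\<lambda>i. prob_yes \<pi> i * max 0 (logit (\<pi> i * prob_yes \<pi> i / m))
      + (1 - prob_yes \<pi> i) * max 0 (logit (\<pi> i * (1 - prob_yes \<pi> i) / (1 - m))))"
  have m: "0 < m" "m < 1" using marg_yes_range[OF assms] by (auto simp: m_def)
  \<comment> \<open>Multiplying by the predictive probability of the answer cancels the
    normalisation of the posterior, leaving for each \<open>i\<close> the expectation over answers
    given that target.\<close>
  have E: "expect_next \<pi> gain = (\<Sum>i\<in>N. \<pi> i * E i)"
    unfolding expect_next_def gain_def update_True update_False[OF assms] m_def[symmetric]
      sum_distrib_left sum.distrib[symmetric] E_def
    using m by (intro sum.cong refl) (simp add: field_simps)
  have pos: "0 < \<pi> i" if "i \<in> N" for i using that assms by (simp add: belief_def)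
  have drift: "logit (\<pi> i) + bern_kl (prob_yes \<pi> i) (rest_yes \<pi> i) \<le> E i"
    "max 0 (logit (\<pi> i)) \<le> E i" if "i \<in> N" for i
    unfolding E_def m_def rest_yes_spec(1)[OF assms that]
    using pos[OF that] belief_less_1[OF assms that] prob_yes_range[OF assms, of i]
      rest_yes_spec(2,3)[OF assms that] noise_range[OF assms]
    by (intro max0_logit_drift; simp)+
  show "gain \<pi> \<le> expect_next \<pi> gain"
    unfolding E gain_def using drift(2) pos by (intro sum_mono mult_left_mono) (auto intro: less_imp_le)
  show "gain \<pi> + \<pi> k * C1 (p (delta L)) \<le> expect_next \<pi> gain"
    if k: "k \<in> N" "query L \<pi> = {k}" "1/2 \<le> \<pi> k"
  proof -
    have q: "noise \<pi> = p (delta L)" using k by simp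
    have "rest_yes \<pi> k = (\<Sum>j\<in>N - {k}. \<pi> j * noise \<pi>) / (1 - \<pi> k)"
      unfolding rest_yes_def using k
      by (intro arg_cong[of _ _ "\<lambda>x. x / _"] sum.cong) (auto simp: prob_yes_def)
    then have "rest_yes \<pi> k = noise \<pi>"
      using belief_less_1[OF assms k(1)] by (simp flip: sum_distrib_right)
    moreover have "prob_yes \<pi> k = 1 - noise \<pi>" using k by (simp add: prob_yes_def)
    \<comment> \<open>Exchanging the two outcomes shows that the divergence of Bern(1-q) from
      Bern(q) equals \<open>C1 q\<close>.\<close>
    ultimately have "logit (\<pi> k) + C1 (p (delta L)) \<le> E k"
      using drift(1)[OF k(1)] q by (simp add: C1_def bern_kl_def add_ac)
    \<comment> \<open>At mass at least 1/2 the truncation does not change the initial log-odds, so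
      the full drift is kept.\<close>
    moreover have "0 \<le> logit (\<pi> k)"
      unfolding logit_def using k(3) belief_less_1[OF assms k(1)] by (intro ln_ge_zero) auto
    ultimately have "\<pi> k * max 0 (logit (\<pi> k)) + \<pi> k * C1 (p (delta L)) \<le> \<pi> k * E k"
      using pos[OF k(1)] by (simp flip: distrib_left)
    moreover have "(\<Sum>i\<in>N - {k}. \<pi> i * max 0 (logit (\<pi> i))) \<le> (\<Sum>i\<in>N - {k}. \<pi> i * E i)"
      using drift(2) pos by (intro sum_mono mult_left_mono) (auto intro: less_imp_le)
    moreover have "(\<Sum>i\<in>N. f i) = f k + (\<Sum>i\<in>N - {k}. f i)" for f :: "nat \<Rightarrow> real"
      by (rule sum.remove[OF _ k(1)]) simp
    ultimately show ?thesis
      unfolding E gain_def by (smt (verit))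
  qed
qed

subsection \<open>The potential\<close>

definition jump :: real where
  "jump = ln ((1 - p (delta L)) / p (delta L))"

definition cap :: real where
  "cap = ln (1 / \<epsilon>) + jump"

text \<open>Invariant up to and including the stopping time. It bounds \<open>gain\<close> by
  \<open>cap\<close>, which keeps the potential nonnegative.\<close>

definition admissible :: "(nat \<Rightarrow> real) \<Rightarrow> bool" where
  "admissible \<pi> \<longleftrightarrow> belief L \<pi> \<and> (\<forall>i\<in>N. logit (\<pi> i) \<le> cap)"

text \<open>
  The three terms pay, respectively, for queries at level at least \<open>l\<close> together with wrongly queried
  leaves, for queries above level \<open>l\<close>, and for querying the true leaf. Since one observation
  raises a log-odds by at most \<open>jump\<close>, the constant \<open>cap\<close> includes the overshoot at stopping.
\<close>

definition potential :: "nat \<Rightarrow> (nat \<Rightarrow> real) \<Rightarrow> real" where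
  "potential l \<pi> = ent N \<pi> / mutual_info (1/3) (p (1 / 2 ^ l))
     + coarse_ent l \<pi> / mutual_info (1/3) (p (1/2))
     + (cap - gain \<pi>) / C1 (p (delta L))"

lemma p_level: "1 \<le> l \<Longrightarrow> 0 < p (1 / 2 ^ l) \<and> p (1 / 2 ^ l) < 1/2"
  using power_increasing[of 1 l "2::real"] by (intro p_range) (auto simp: field_simps)

lemma p_delta: "0 < p (delta L)" "p (delta L) < 1/2"
  using p_range[OF delta_range(1)] by auto

lemma cap_nonneg: "0 \<le> cap"
proof -
  have "0 \<le> ln (1 / \<epsilon>)" using eps_range by (intro ln_ge_zero) auto
  moreover have "0 \<le> jump" unfolding jump_def using p_delta by (intro ln_ge_zero) auto
  ultimately show ?thesis by (simp add: cap_def)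
qed

lemma potential_nonneg:
  assumes "admissible \<pi>" "1 \<le> l" "l \<le> L"
  shows "0 \<le> potential l \<pi>"
proof -
  have \<pi>: "belief L \<pi>" "\<And>i. i \<in> N \<Longrightarrow> logit (\<pi> i) \<le> cap"
    using assms by (auto simp: admissible_def)
  have "gain \<pi> \<le> (\<Sum>i\<in>N. \<pi> i * cap)"
    unfolding gain_def using \<pi> cap_nonneg
    by (intro sum_mono mult_left_mono) (auto simp: belief_def intro: less_imp_le)
  also have "\<dots> = cap" using \<pi>(1) by (simp add: belief_def flip: sum_distrib_right)
  finally have "gain \<pi> \<le> cap" .
  moreover have "0 \<le> ent N \<pi>" using \<pi>(1) by (intro ent_nonneg) (auto simp: belief_def)
  moreover have "0 \<le> coarse_ent l \<pi>"
    unfolding coarse_ent_def using coarse_belief[OF \<pi>(1) assms(3)] belief_piS_pos[OF \<pi>(1) assms(3)]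
    by (intro ent_nonneg) auto
  ultimately show ?thesis
    unfolding potential_def
    using mutual_info_pos[of "1/3" "p (1 / 2 ^ l)"] mutual_info_pos[of "1/3" "p (1 / 2)"]
      C1_pos[OF p_delta] p_level[OF assms(2)] p_level[of 1]
    by (intro add_nonneg_nonneg divide_nonneg_nonneg) auto
qed

lemma expect_next_potential:
  "expect_next \<pi> (potential l) = expect_next \<pi> (ent N) / mutual_info (1/3) (p (1 / 2 ^ l))
     + expect_next \<pi> (coarse_ent l) / mutual_info (1/3) (p (1/2))
     + (cap - expect_next \<pi> gain) / C1 (p (delta L))"
  by (simp add: expect_next_def potential_def add_divide_distrib diff_divide_distrib algebra_simps)

text \<open>Deeper cells are smaller and thus queried with no more noise.\<close>

lemma mutual_info_level:
  assumes "1 \<le> i" "i \<le> j"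
  shows "mutual_info (1/3) (p (1 / 2 ^ i)) \<le> mutual_info (1/3) (p (1 / 2 ^ j))"
  using noise_mono[OF assms] p_level[of i] p_level[of j] assms
  by (intro mutual_info_antimono) auto

text \<open>Every query is charged a unit cost. The position of \<open>lstar\<close> relative to
  \<open>l\<close> and \<open>L\<close> decides which terms pay it, while the other terms do not
  rise in expectation.\<close>

lemma potential_drift:
  assumes \<pi>: "belief L \<pi>" and l: "1 \<le> l" "l \<le> L"
  shows "expect_next \<pi> (potential l) \<le> potential l \<pi> - 1"
proof -
  define I where "I = mutual_info (1/3) (p (1 / 2 ^ l))"
  define I1 where "I1 = mutual_info (1/3) (p (1/2))"
  define C where "C = C1 (p (delta L))"
  obtain j m where jm: "query L \<pi> = H L j m" "m < 2 ^ j" "1 \<le> j" "j \<le> L"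
    "lstar L \<pi> \<le> j" "j \<le> lstar L \<pi> + 1"
    and mid: "lstar L \<pi> < L \<Longrightarrow> 1/3 \<le> piS \<pi> (H L j m) \<and> piS \<pi> (H L j m) \<le> 2/3"
    and leaf_mass: "lstar L \<pi> = L \<Longrightarrow> 1/2 \<le> piS \<pi> (H L j m)"
    using query_spec[OF \<pi> L_pos] by metis
  define s where "s = piS \<pi> (H L j m)"
  define q where "q = p (1 / 2 ^ j)"
  have noise: "noise \<pi> = q" using noise_level[OF jm(1,3,4)] by (simp add: q_def)
  have q: "0 < q" "q < 1" "q < 1/2" using p_level[OF jm(3)] by (auto simp: q_def)
  have pos: "0 < I" "0 < I1" "0 < C"
    unfolding I_def I1_def C_def using p_level[OF l(1)] p_level[of 1] C1_pos[OF p_delta]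
    by (auto intro: mutual_info_pos)
  have s: "0 \<le> s" "s \<le> 1"
    using belief_piS_pos[OF \<pi> jm(4,2)] belief_piS_le[OF \<pi> H_subset[OF jm(4,2)]]
    by (auto simp: s_def)
  have fine: "expect_next \<pi> (ent N) = ent N \<pi> - mutual_info s q"
    using ent_drift[OF \<pi>] unfolding noise unfolding jm(1) s_def .
  have MI: "0 \<le> mutual_info s q" using s q by (intro mutual_info_nonneg) auto
  have coarse: "expect_next \<pi> (coarse_ent l) \<le> coarse_ent l \<pi>"
    using coarse_ent_drift_le[OF \<pi> l(2)] .
  have gain: "gain \<pi> \<le> expect_next \<pi> gain" using gain_drift_le(1)[OF \<pi>] .
  \<comment> \<open>The shares of the unit cost paid by the entropy, the coarse entropy and the
    log-odds are \<open>x\<close>, \<open>y\<close> and \<open>z\<close>.\<close>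
  have finish: ?thesis
    if "1 \<le> x + y + z" "expect_next \<pi> (ent N) \<le> ent N \<pi> - I * x"
      "expect_next \<pi> (coarse_ent l) \<le> coarse_ent l \<pi> - I1 * y"
      "gain \<pi> + C * z \<le> expect_next \<pi> gain" for x y z
  proof -
    have "expect_next \<pi> (ent N) / I \<le> ent N \<pi> / I - x"
      "expect_next \<pi> (coarse_ent l) / I1 \<le> coarse_ent l \<pi> / I1 - y"
      using that(2,3) pos by (simp_all add: field_simps)
    moreover have "(cap - expect_next \<pi> gain) / C \<le> (cap - gain \<pi> - C * z) / C"
      using that(4) pos by (intro divide_right_mono) auto
    then have "(cap - expect_next \<pi> gain) / C \<le> (cap - gain \<pi>) / C - z"
      using pos by (simp add: diff_divide_distrib)
    ultimately show ?thesis
      unfolding expect_next_potential potential_def I_def[symmetric] I1_def[symmetric] C_def[symmetric]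
      using that(1) by linarith
  qed
  consider (leaf) "lstar L \<pi> = L" | (deep) "l \<le> lstar L \<pi>" "lstar L \<pi> < L" | (top) "lstar L \<pi> < l"
    using lstar_spec(1)[OF \<pi>] l by linarith
  then show ?thesis
  proof cases
    case leaf
    \<comment> \<open>The log-odds pay \<open>s\<close> of the unit cost, the entropy pays the remaining \<open>1 - s\<close>.\<close>
    then have j: "j = L" using jm by simp
    have S: "query L \<pi> = {m + 1}" using jm(1) j by (simp add: H_def)
    then have s_eq: "s = \<pi> (m + 1)" using jm(1) by (simp add: s_def piS_def)
    have s2: "1/2 \<le> s" using leaf leaf_mass by (simp add: s_def)
    have mem: "m + 1 \<in> N" using jm(2) j by simp
    have "I \<le> mutual_info (1/3) q" unfolding I_def q_def j using l by (intro mutual_info_level)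
    then have "(1 - s) * I \<le> (1 - s) * mutual_info (1/3) q" using s by (intro mult_left_mono) auto
    also have "\<dots> \<le> mutual_info s q" using q s s2 by (intro mutual_info_large) auto
    finally have "I * (1 - s) \<le> mutual_info s q" by (simp add: mult.commute)
    moreover have "gain \<pi> + C * s \<le> expect_next \<pi> gain"
      using gain_drift_le(2)[OF \<pi> mem S] s2 unfolding s_eq C_def by (simp add: mult.commute)
    ultimately show ?thesis using fine coarse by (intro finish[of "1 - s" 0 s]) auto
  next
    \<comment> \<open>The query is balanced and at level at least \<open>l\<close>, so its noise is
      at most that of level \<open>l\<close>.\<close>
    case deep
    have "I \<le> mutual_info (1/3) q"
      unfolding I_def q_def using l deep jm by (intro mutual_info_level) auto
    also have "\<dots> \<le> mutual_info s q" using mid deep q by (intro mutual_info_middle) (auto simp: s_def)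
    finally show ?thesis using fine coarse gain by (intro finish[of 1 0 0]) auto
  next
    \<comment> \<open>The query lies at level at most \<open>lstar L \<pi> + 1 \<le> l\<close>, so
      all its information is about the level-\<open>l\<close> cell. With noise at most
      \<open>p (1/2)\<close> this is at least \<open>I1\<close>.\<close>
    case top
    have "I1 \<le> mutual_info (1/3) q"
      using mutual_info_level[of 1 j] jm by (simp add: I1_def q_def)
    also have "\<dots> \<le> mutual_info s q"
      using mid top l q by (intro mutual_info_middle) (auto simp: s_def)
    finally have "I1 \<le> mutual_info s q" .
    moreover have "expect_next \<pi> (coarse_ent l) = coarse_ent l \<pi> - mutual_info s q"
      using coarse_ent_drift[OF \<pi> l(2) jm(1,2)] top jm(6) unfolding noise unfolding jm(1) s_def by simp
    ultimately show ?thesis using fine gain MI by (intro finish[of 0 1 0]) auto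
  qed
qed

text \<open>Not having stopped bounds each log-odds by \<open>ln (1 / \<epsilon>)\<close>, and one
  further answer adds at most \<open>jump\<close>.\<close>

lemma admissible_update:
  assumes "belief L \<pi>" "\<not> stopped L \<epsilon> \<pi>"
  shows "admissible (update L p \<pi> y)"
proof -
  have "logit (update L p \<pi> y i) \<le> cap" if i: "i \<in> N" for i
  proof -
    have "\<pi> i \<le> 1 - \<epsilon>" "0 < \<pi> i" "\<pi> i < 1"
      using assms i belief_less_1[OF assms(1) i] by (auto simp: stopped_def belief_def not_less)
    then have "logit (\<pi> i) \<le> ln (1 / \<epsilon>)"
      unfolding logit_def using eps_range
      by (subst ln_le_cancel_iff) (auto intro!: frac_le)
    then show ?thesis using logit_update_le[OF assms(1) i, of y] by (simp add: cap_def jump_def)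
  qed
  then show ?thesis using belief_update[OF assms(1)] by (simp add: admissible_def)
qed

text \<open>Probability that the search started from the given posterior has not stopped by time
  \<open>t\<close>, computed by conditioning on the first answer.\<close>

fun survive :: "nat \<Rightarrow> (nat \<Rightarrow> real) \<Rightarrow> real" where
  "survive 0 \<pi> = (if stopped L \<epsilon> \<pi> then 0 else 1)"
| "survive (Suc t) \<pi> = (if stopped L \<epsilon> \<pi> then 0 else expect_next \<pi> (survive t))"

lemma survive_nonneg: "belief L \<pi> \<Longrightarrow> 0 \<le> survive t \<pi>"
proof (induction t arbitrary: \<pi>)
  case (Suc t)
  then show ?case using marg_yes_range[OF Suc.prems] belief_update[OF Suc.prems]
    by (auto simp: expect_next_def)
qed auto

text \<open>Optional stopping with a finite horizon: each step before stopping costs 1 and lowers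
  the potential by at least 1 on average, and nonnegativity discards what remains at the
  end.\<close>

lemma sum_survive_le:
  assumes "admissible \<pi>" "1 \<le> l" "l \<le> L"
  shows "(\<Sum>t<T. survive t \<pi>) \<le> potential l \<pi>"
  using assms(1)
proof (induction T arbitrary: \<pi>)
  case 0
  then show ?case using potential_nonneg assms by simp
next
  case (Suc T)
  have \<pi>: "belief L \<pi>" using Suc.prems by (simp add: admissible_def)
  show ?case
  proof (cases "stopped L \<epsilon> \<pi>")
    case True
    then have "survive t \<pi> = 0" for t by (cases t) auto
    then show ?thesis using potential_nonneg[OF Suc.prems] assms by simp
  next
    case False
    have IH: "(\<Sum>t<T. survive t (update L p \<pi> y)) \<le> potential l (update L p \<pi> y)" for y
      using admissible_update[OF \<pi> False] by (rule Suc.IH)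
    \<comment> \<open>The term for time 0 is 1 because the search has not stopped; the others are
      shifted to the next posterior.\<close>
    have "(\<Sum>t<Suc T. survive t \<pi>) = 1 + expect_next \<pi> (\<lambda>\<pi>. \<Sum>t<T. survive t \<pi>)"
      unfolding sum.lessThan_Suc_shift using False
      by (simp add: expect_next_def sum.distrib sum_distrib_left)
    also have "\<dots> \<le> 1 + expect_next \<pi> (potential l)"
      unfolding expect_next_def using marg_yes_range[OF \<pi>] IH
      by (intro add_mono mult_left_mono order_refl) auto
    also have "\<dots> \<le> potential l \<pi>" using potential_drift[OF \<pi> assms(2,3)] by simp
    finally show ?thesis .
  qed
qed

section \<open>Tail probabilities as sums over observation sequences\<close>

abbreviation post_from :: "(nat \<Rightarrow> real) \<Rightarrow> bool list \<Rightarrow> (nat \<Rightarrow> real)" where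
  "post_from \<pi> ys \<equiv> fold (\<lambda>y \<pi>. update L p \<pi> y) ys \<pi>"

text \<open>The summand of \<open>tail_prob\<close> for an arbitrary starting belief, since
  induction from the front of the sequence changes that belief.\<close>

definition path_weight :: "(nat \<Rightarrow> real) \<Rightarrow> nat \<Rightarrow> bool list \<Rightarrow> real" where
  "path_weight \<pi> i ys = (\<Prod>t<length ys. lik L p (post_from \<pi> (take t ys)) i (ys ! t)) *
     (if \<forall>s\<le>length ys. \<not> stopped L \<epsilon> (post_from \<pi> (take s ys)) then 1 else 0)"

lemma path_weight_Cons:
  "path_weight \<pi> i (y # ys) =
     (if stopped L \<epsilon> \<pi> then 0 else lik L p \<pi> i y * path_weight (update L p \<pi> y) i ys)"
proof -
  have all: "(\<forall>s\<le>Suc n. P s) \<longleftrightarrow> P 0 \<and> (\<forall>s\<le>n. P (Suc s))" for P n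
    by (metis le0 not0_implies_Suc Suc_le_mono)
  show ?thesis
    unfolding path_weight_def length_Cons prod.lessThan_Suc_shift all by simp
qed

text \<open>After the first answer is split off, Bayes' rule turns prior times likelihood into
  predictive probability times updated posterior, which gives the recursion of
  \<open>survive\<close>.\<close>

lemma survive_eq:
  assumes "belief L \<pi>"
  shows "survive t \<pi> = (\<Sum>i\<in>N. \<pi> i * (\<Sum>ys\<in>{ys. length ys = t}. path_weight \<pi> i ys))"
  using assms
proof (induction t arbitrary: \<pi>)
  case 0
  then show ?case by (simp add: path_weight_def belief_def)
next
  case (Suc t)
  let ?R = "\<lambda>y i. \<Sum>ys\<in>{ys. length ys = t}. path_weight (update L p \<pi> y) i ys"
  note m = marg_yes_range[OF Suc.prems]
  show ?case
  proof (cases "stopped L \<epsilon> \<pi>")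
    case False
    have "(\<Sum>ys\<in>{ys. length ys = Suc t}. path_weight \<pi> i ys)
        = prob_yes \<pi> i * ?R True i + (1 - prob_yes \<pi> i) * ?R False i" for i
      using False by (simp add: sum_lists_Suc path_weight_Cons lik_True lik_False sum_distrib_left)
    then have "(\<Sum>i\<in>N. \<pi> i * (\<Sum>ys\<in>{ys. length ys = Suc t}. path_weight \<pi> i ys))
        = (\<Sum>i\<in>N. \<pi> i * prob_yes \<pi> i * ?R True i + \<pi> i * (1 - prob_yes \<pi> i) * ?R False i)"
      by (simp add: distrib_left mult.assoc)
    also have "\<dots> = marg_yes \<pi> * (\<Sum>i\<in>N. update L p \<pi> True i * ?R True i)
        + (1 - marg_yes \<pi>) * (\<Sum>i\<in>N. update L p \<pi> False i * ?R False i)"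
      using m by (simp add: update_True update_False[OF Suc.prems] sum.distrib sum_distrib_left)
    also have "\<dots> = survive (Suc t) \<pi>"
      using False Suc.IH[OF belief_update[OF Suc.prems]] by (simp add: expect_next_def)
    finally show ?thesis by simp
  qed (simp add: sum_lists_Suc path_weight_Cons)
qed

section \<open>Initial values and the resulting bound\<close>

lemma belief_prior: "belief L (prior L)"
  by (simp add: belief_def prior_def delta_def)

lemma tail_prob_eq: "tail_prob L p \<epsilon> t = survive t (prior L)"
proof -
  have "tail_prob L p \<epsilon> t = (\<Sum>i\<in>N. prior L i * (\<Sum>ys\<in>{ys. length ys = t}. path_weight (prior L) i ys))"
    unfolding tail_prob_def
    by (intro sum.cong arg_cong2[of _ _ _ _ "(*)"])
       (auto simp: prior_def path_weight_def obs_prob_def post_def)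
  then show ?thesis using survive_eq[OF belief_prior] by simp
qed

text \<open>The truncated log-odds vanish at the uniform prior because
  \<open>delta L \<le> 1/2\<close>. The last summand is the overshoot \<open>jump\<close> divided by
  \<open>C1\<close>, simplified by \<open>C1_eq\<close>.\<close>

lemma potential_prior:
  assumes "l \<le> L"
  shows "potential l (prior L) = real L * ln 2 / mutual_info (1/3) (p (1 / 2 ^ l))
     + real l * ln 2 / mutual_info (1/3) (p (1/2))
     + ln (1 / \<epsilon>) / C1 (p (delta L)) + 1 / (1 - 2 * p (delta L))"
proof -
  have "ent N (prior L) = real L * ln 2"
    by (rule ent_uniform) (auto simp: prior_def delta_def)
  moreover have "coarse_ent l (prior L) = real l * ln 2"
    unfolding coarse_ent_def
  proof (rule ent_uniform)
    fix m assume "m \<in> {..<(2::nat) ^ l}"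
    then have "piS (prior L) (H L l m) = (\<Sum>i\<in>H L l m. delta L)"
      unfolding piS_def using H_subset[OF assms, of m] by (intro sum.cong) (auto simp: prior_def)
    also have "\<dots> = 2 ^ (L - l) / (2 ^ l * 2 ^ (L - l))"
      using assms by (simp add: delta_def flip: power_add)
    finally show "piS (prior L) (H L l m) = 1 / 2 ^ l" by simp
  qed auto
  moreover have "gain (prior L) = 0"
  proof -
    have "logit (delta L) \<le> 0"
      unfolding logit_def using delta_range by (subst ln_le_zero_iff) auto
    then show ?thesis by (simp add: gain_def prior_def)
  qed
  moreover have "cap / C1 (p (delta L)) = ln (1 / \<epsilon>) / C1 (p (delta L)) + 1 / (1 - 2 * p (delta L))"
  proof -
    have "0 < jump" unfolding jump_def using p_delta by (intro ln_gt_zero) auto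
    then show ?thesis using p_delta by (simp add: cap_def add_divide_distrib C1_eq jump_def[symmetric])
  qed
  ultimately show ?thesis by (simp add: potential_def)
qed

lemma admissible_prior: "admissible (prior L)"
proof -
  have "logit (delta L) \<le> 0"
    unfolding logit_def using delta_range by (subst ln_le_zero_iff) auto
  then show ?thesis using cap_nonneg belief_prior by (auto simp: admissible_def prior_def)
qed

text \<open>The partial sums of the tails stay below the initial potential, hence so does their
  supremum. Raising the noise in the overshoot term to \<open>p (1/2)\<close> makes that term
  independent of \<open>L\<close>.\<close>

lemma expected_tau_le:
  assumes "1 \<le> l" "l \<le> L"
  shows "expected_tau L p \<epsilon> \<le> ennreal (real L * ln 2 / mutual_info (1/3) (p (1 / 2 ^ l))
     + real l * ln 2 / mutual_info (1/3) (p (1/2))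
     + ln (1 / \<epsilon>) / C1 (p (delta L)) + 1 / (1 - 2 * p (1/2)))"
proof -
  have "p (delta L) \<le> p (1/2)" using delta_range by (intro mono_onD[OF p_mono]) auto
  then have "1 / (1 - 2 * p (delta L)) \<le> 1 / (1 - 2 * p (1/2))"
    using p_level[of 1] by (intro divide_left_mono) auto
  then have le: "potential l (prior L) \<le> real L * ln 2 / mutual_info (1/3) (p (1 / 2 ^ l))
     + real l * ln 2 / mutual_info (1/3) (p (1/2))
     + ln (1 / \<epsilon>) / C1 (p (delta L)) + 1 / (1 - 2 * p (1/2))"
    unfolding potential_prior[OF assms(2)] by simp
  have "expected_tau L p \<epsilon> \<le> ennreal (potential l (prior L))"
    unfolding expected_tau_def suminf_eq_SUP tail_prob_eq
    using sum_survive_le[OF admissible_prior assms] survive_nonneg[OF belief_prior]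
    by (intro SUP_least) (simp add: sum_ennreal ennreal_leI)
  also have "\<dots> \<le> ennreal (real L * ln 2 / mutual_info (1/3) (p (1 / 2 ^ l))
     + real l * ln 2 / mutual_info (1/3) (p (1/2))
     + ln (1 / \<epsilon>) / C1 (p (delta L)) + 1 / (1 - 2 * p (1/2)))"
    using le by (rule ennreal_leI)
  finally show ?thesis .
qed

end

text \<open>Since \<open>ln (1 / (delta L * \<epsilon>))\<close> grows without bound when either
  parameter tends to 0, the error term is expressed by a threshold \<open>M\<close> for each
  \<open>\<eta>\<close>, uniform in \<open>L\<close> and \<open>\<epsilon>\<close>.\<close>

theorem theorem2:
  fixes p :: "real \<Rightarrow> real" and l :: nat
  assumes p_range: "\<forall>x\<in>{0<..<1}. 0 < p x \<and> p x < 1/2"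
    and p_cont: "continuous_on {0<..<1} p"
    and p_mono: "mono_on {0<..<1} p"
    and l_pos: "l > 0"
  shows "K_h p > 0 \<and>
    (\<forall>\<eta>>0. \<exists>M. \<forall>(L::nat) (\<epsilon>::real).
        L \<ge> 1 \<longrightarrow> 0 < \<epsilon> \<longrightarrow> \<epsilon> < 1 \<longrightarrow>
        ln (1 / (delta L * \<epsilon>)) \<ge> M \<longrightarrow>
        2 powr (- real l) > (exp 1 * ln (1 / (delta L * \<epsilon>))) powr (- K_h p) \<longrightarrow>
        expected_tau L p \<epsilon> \<le>
          ennreal (ln (1 / delta L) / mutual_info (1/3) (p (2 powr (- real l)))
                   + ln (1 / \<epsilon>) / C1 (p (delta L))
                   + \<eta> * ln (1 / (delta L * \<epsilon>))))"
proof (intro conjI allI impI)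
  have half: "0 < p (1/2)" "p (1/2) < 1/2" using p_range by auto
  show "K_h p > 0" using half by (rule K_h_pos)
  fix \<eta> :: real assume \<eta>: "\<eta> > 0"
  define I where "I = mutual_info (1/3) (p (1/2))"
  \<comment> \<open>Collects the terms independent of \<open>L\<close> and
    \<open>\<epsilon>\<close>. The factor 2 is generous enough to cover \<open>L < l\<close> as
    well, where the entropy cost is charged to this constant.\<close>
  define c where "c = 2 * real l * ln 2 / I + 1 / (1 - 2 * p (1/2))"
  have I: "0 < I" unfolding I_def using half by (intro mutual_info_pos) auto
  have lvl: "2 powr (- real l) = 1 / (2::real) ^ l"
    by (simp add: powr_minus powr_realpow divide_inverse)
  have "(1::real) / 2 ^ l \<in> {0<..<1}" using l_pos by auto
  then have pl: "0 < p (1 / 2 ^ l)" "p (1 / 2 ^ l) < 1/2" using p_range by blast+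
  have Il: "0 < mutual_info (1/3) (p (1 / 2 ^ l))"
    using pl by (intro mutual_info_pos) auto
  show "\<exists>M. \<forall>(L::nat) (\<epsilon>::real).
        L \<ge> 1 \<longrightarrow> 0 < \<epsilon> \<longrightarrow> \<epsilon> < 1 \<longrightarrow>
        ln (1 / (delta L * \<epsilon>)) \<ge> M \<longrightarrow>
        2 powr (- real l) > (exp 1 * ln (1 / (delta L * \<epsilon>))) powr (- K_h p) \<longrightarrow>
        expected_tau L p \<epsilon> \<le>
          ennreal (ln (1 / delta L) / mutual_info (1/3) (p (2 powr (- real l)))
                   + ln (1 / \<epsilon>) / C1 (p (delta L))
                   + \<eta> * ln (1 / (delta L * \<epsilon>)))"
  \<comment> \<open>Beyond this threshold the constant \<open>c\<close> is at most
    \<open>\<eta> * ln (1 / (delta L * \<epsilon>))\<close>.\<close>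
  proof (intro exI[of _ "c / \<eta>"] allI impI)
    fix L :: nat and \<epsilon> :: real
    assume L: "1 \<le> L" and \<epsilon>: "0 < \<epsilon>" "\<epsilon> < 1" and M: "c / \<eta> \<le> ln (1 / (delta L * \<epsilon>))"
    interpret hiepm L p \<epsilon> using L \<epsilon> p_range p_mono by unfold_locales auto
    define B where "B = real L * ln 2 / mutual_info (1/3) (p (1 / 2 ^ l))"
    have "c \<le> \<eta> * ln (1 / (delta L * \<epsilon>))" using M \<eta> by (simp add: field_simps)
    moreover have "ln (1 / delta L) = real L * ln 2" by (simp add: delta_def ln_realpow)
    moreover have "expected_tau L p \<epsilon> \<le> ennreal (B + ln (1 / \<epsilon>) / C1 (p (delta L)) + c)"
    proof (cases "l \<le> L")
      case True
      have "real l * ln 2 / I \<le> 2 * real l * ln 2 / I" using I by (intro divide_right_mono) auto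
      then show ?thesis
        using True l_pos
        by (intro order_trans[OF expected_tau_le[of l] ennreal_leI]) (auto simp: B_def c_def I_def)
    next
      \<comment> \<open>There are no cells at level \<open>l\<close>, so the bound is taken at level
        1. Its entropy terms add up to \<open>(L + 1) * ln 2 / I\<close>, which \<open>c\<close>
        absorbs because \<open>L < l\<close>.\<close>
      case False
      have "real L * ln 2 / I + real 1 * ln 2 / I \<le> 2 * real l * ln 2 / I"
      proof -
        have "(real L + real 1) * ln 2 / I \<le> (2 * real l) * ln 2 / I"
          using I False L by (intro divide_right_mono mult_right_mono) auto
        then show ?thesis by (simp only: distrib_right add_divide_distrib)
      qed
      moreover have "0 \<le> B" using Il by (simp add: B_def)
      ultimately show ?thesis
        using L
        by (intro order_trans[OF expected_tau_le[of 1] ennreal_leI]) (auto simp: c_def I_def)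
    qed
    ultimately show "expected_tau L p \<epsilon> \<le>
          ennreal (ln (1 / delta L) / mutual_info (1/3) (p (2 powr (- real l)))
                   + ln (1 / \<epsilon>) / C1 (p (delta L))
                   + \<eta> * ln (1 / (delta L * \<epsilon>)))"
      unfolding lvl by (elim order_trans) (auto simp: B_def intro!: ennreal_leI)
  qed
qed

end
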